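(* Let $\Lambda_{\mathcal F}(p)$ be the coin tossing integer self-similar set on the line with IFS $\mathcal F$ and parameter $p\in(0,1)$. Suppose that the following two conditions hold: (1) $p\cdot CS_{a,U}>1$ for all $a\in[L]$ and all $U\in[N]$; (2) there exist a finite word $\underline b\in[L]^*$ and $U\in[N]$ such that $A_{\underline b}(U,V)>0$ for all $V\in[N]$. Then $\Lambda_{\mathcal F}(p)$ contains an interval almost surely conditioned on non-extinction.
   Context: Notation: $[k]:=\{0,1,\dots,k-1\}$; $[L]^*$ is the set of finite words over $[L]$; "interval" means nondegenerate interval. IFS: $\mathcal F=\{f_i(x)=\frac1L x+t_i\}_{i=0}^{M-1}$ on $\mathbb R$, where $L\in\mathbb N$, $L\ge2$, $t_i\in\mathbb N$ ($0\in\mathbb N$), $0=t_0\le t_1\le\dots\le t_{M-1}$, and $L-1$ divides $t_{M-1}$. Repetitions among the $f_i$ are allowed. Write $f_{i_1\dots i_n}=f_{i_1}\circ\dots\circ f_{i_n}$. Coin tossing self-similar set: give each nonempty finite word $\mathbf i$ over $[M]$ an independent Bernoulli($p$) label. Let $\mathcal E_n\subset[M]^n$ be the random set of words $i_1\dots i_n$ such that all of the words $i_1,\ i_1i_2,\dots,\ i_1\dots i_n$ have label $1$. With $I=[0,\frac{L\,t_{M-1}}{L-1}]$ (so $f_i(I)\subset I$ for all $i$), $\Lambda_{\mathcal F}(p):=\bigcap_{n\ge1}\bigcup_{\mathbf i\in\mathcal E_n}f_{\mathbf i}(I)$. Non-extinction is the event that $\mathcal E_n\ne\emptyset$ for all $n$;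 a property holds "almost surely conditioned on non-extinction" if the event that non-extinction occurs and the property fails has probability $0$. Distinct maps: let $\mathcal S=\{S_j(x)=\frac1Lx+t_j'\}_{j=0}^{m-1}$ be the distinct elements of $\mathcal F$ and $n_j=\#\{i\in[M]:f_i=S_j\}$. Let $\nu$ be the self-similar probability measure of $\mathcal S$ with weights $q_j=n_j/M$, i.e. the push-forward of the product measure $(q_0,\dots,q_{m-1})^{\mathbb N}$ under $i_1i_2\dots\mapsto\lim_n S_{i_1}\circ\dots\circ S_{i_n}(0)$. Basic types: $J^0,\dots,J^{N-1}$ are the finitely many intervals of the form $[(i-1)L,iL]$, $i\in\mathbb Z$, having positive $\nu$-measure, in increasing order (they cover the support of $\nu$). If $J^k=[uL,(u+1)L]$ and $\underline a=(a_1,\dots,a_n)\in[L]^n$, then $J^k_{\underline a}$ is the closed interval of length $L^{1-n}$ with left endpoint $uL+\sum_{j=1}^n a_jL^{1-j}$. Matrices: for $a\in[L]$, $A_a$ is the $N\times N$ matrix, with rows and columns indexed by $[N]$, given by $A_a(\ell,k)=n_i$ if there is an $i\in[m]$ with $S_i(J^k)=J^\ell_a$ (such $i$ is unique), and $A_a(\ell,k)=0$ otherwise. For $\underline a\in[L]^n$, $A_{\underline a}=A_{a_1}\cdots A_{a_n}$. Column sums: $CS_{a,j}=\sum_{i=0}^{N-1}A_a(i,j)$. *)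

theory Defs
  imports "HOL-Probability.Probability" "Jordan_Normal_Form.Matrix"
begin

text \<open>
  The data of the IFS are the contraction parameter \<open>L\<close>, the number of maps \<open>M\<close> and the
  translations \<open>t 0, ..., t (M - 1)\<close>; the values of \<open>t\<close> outside \<open>{..<M}\<close> are irrelevant.  Words are
  lists, with the first letter at the head.
\<close>

definition words :: "nat \<Rightarrow> nat list set" where
  "words k = {w. set w \<subseteq> {..<k}}"

definition ifs_map :: "nat \<Rightarrow> (nat \<Rightarrow> nat) \<Rightarrow> nat \<Rightarrow> real \<Rightarrow> real" where
  "ifs_map L t i = (\<lambda>x. x / real L + real (t i))"

definition ifs_word :: "nat \<Rightarrow> (nat \<Rightarrow> nat) \<Rightarrow> nat list \<Rightarrow> real \<Rightarrow> real" where
  "ifs_word L t w = foldr (\<lambda>i g. ifs_map L t i \<circ> g) w id"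

definition base_interval :: "nat \<Rightarrow> nat \<Rightarrow> (nat \<Rightarrow> nat) \<Rightarrow> real set" where
  "base_interval L M t = {0 .. real L * real (t (M - 1)) / (real L - 1)}"


text \<open>
  \<open>X w \<omega>\<close> is the label of the word \<open>w\<close>, with \<open>True\<close> for the label 1.  The empty word carries no label.
\<close>

definition bernoulli_labels ::
    "'w measure \<Rightarrow> (nat list \<Rightarrow> 'w \<Rightarrow> bool) \<Rightarrow> nat \<Rightarrow> real \<Rightarrow> bool" where
  "bernoulli_labels P X M p \<longleftrightarrow>
     prob_space.indep_vars P (\<lambda>_. count_space UNIV) X (words M - {[]}) \<and>
     (\<forall>w \<in> words M - {[]}.
        distr P (count_space UNIV) (X w) = measure_pmf (bernoulli_pmf p))"

definition surviving :: "(nat list \<Rightarrow> 'w \<Rightarrow> bool) \<Rightarrow> nat \<Rightarrow> 'w \<Rightarrow> nat \<Rightarrow> nat list set" where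
  "surviving X M \<omega> n =
     {w \<in> words M. length w = n \<and> (\<forall>k\<in>{1..n}. X (take k w) \<omega>)}"

definition coin_set ::
    "nat \<Rightarrow> nat \<Rightarrow> (nat \<Rightarrow> nat) \<Rightarrow> (nat list \<Rightarrow> 'w \<Rightarrow> bool) \<Rightarrow> 'w \<Rightarrow> real set" where
  "coin_set L M t X \<omega> =
     (\<Inter>n\<in>{1..}. \<Union>w\<in>surviving X M \<omega> n. ifs_word L t w ` base_interval L M t)"

definition non_extinct :: "(nat list \<Rightarrow> 'w \<Rightarrow> bool) \<Rightarrow> nat \<Rightarrow> 'w \<Rightarrow> bool" where
  "non_extinct X M \<omega> \<longleftrightarrow> (\<forall>n. surviving X M \<omega> n \<noteq> {})"

definition contains_interval :: "real set \<Rightarrow> bool" where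
  "contains_interval S \<longleftrightarrow> (\<exists>a b. a < b \<and> {a..b} \<subseteq> S)"


text \<open>
  Two maps of the IFS coincide iff their translations do, so the distinct maps are listed via the
  distinct translations, in increasing order.
\<close>

definition num_distinct :: "nat \<Rightarrow> (nat \<Rightarrow> nat) \<Rightarrow> nat" where
  "num_distinct M t = card (t ` {..<M})"

definition distinct_trans :: "nat \<Rightarrow> (nat \<Rightarrow> nat) \<Rightarrow> nat \<Rightarrow> nat" where
  "distinct_trans M t j = sorted_list_of_set (t ` {..<M}) ! j"

definition distinct_map :: "nat \<Rightarrow> nat \<Rightarrow> (nat \<Rightarrow> nat) \<Rightarrow> nat \<Rightarrow> real \<Rightarrow> real" where
  "distinct_map L M t j = ifs_map L (distinct_trans M t) j"

definition multiplicity_of :: "nat \<Rightarrow> nat \<Rightarrow> (nat \<Rightarrow> nat) \<Rightarrow> nat \<Rightarrow> nat" where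
  "multiplicity_of L M t j = card {i \<in> {..<M}. ifs_map L t i = distinct_map L M t j}"

definition weight_measure :: "nat \<Rightarrow> nat \<Rightarrow> (nat \<Rightarrow> nat) \<Rightarrow> nat measure" where
  "weight_measure L M t =
     point_measure {..<num_distinct M t} (\<lambda>j. ennreal (real (multiplicity_of L M t j) / real M))"

definition coding_map :: "nat \<Rightarrow> nat \<Rightarrow> (nat \<Rightarrow> nat) \<Rightarrow> (nat \<Rightarrow> nat) \<Rightarrow> real" where
  "coding_map L M t s =
     lim (\<lambda>n. ifs_word L (distinct_trans M t) (map s [0..<n]) 0)"

definition self_similar_measure :: "nat \<Rightarrow> nat \<Rightarrow> (nat \<Rightarrow> nat) \<Rightarrow> real measure" where
  "self_similar_measure L M t =
     distr (PiM UNIV (\<lambda>_::nat. weight_measure L M t)) borel (coding_map L M t)"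


text \<open>
  \<open>type_indices\<close> is the set of all \<open>u\<close> such that \<open>[u L, (u + 1) L]\<close> has positive measure.  It is
  finite because the measure has bounded support, and \<open>type_index k\<close> is its \<open>k\<close>-th element in
  increasing order.
\<close>

definition type_indices :: "nat \<Rightarrow> nat \<Rightarrow> (nat \<Rightarrow> nat) \<Rightarrow> int set" where
  "type_indices L M t =
     {u. emeasure (self_similar_measure L M t)
           {of_int u * real L .. (of_int u + 1) * real L} > 0}"

definition num_types :: "nat \<Rightarrow> nat \<Rightarrow> (nat \<Rightarrow> nat) \<Rightarrow> nat" where
  "num_types L M t = card (type_indices L M t)"

definition type_index :: "nat \<Rightarrow> nat \<Rightarrow> (nat \<Rightarrow> nat) \<Rightarrow> nat \<Rightarrow> int" where
  "type_index L M t k = sorted_list_of_set (type_indices L M t) ! k"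

definition basic_type :: "nat \<Rightarrow> nat \<Rightarrow> (nat \<Rightarrow> nat) \<Rightarrow> nat \<Rightarrow> real set" where
  "basic_type L M t k =
     {of_int (type_index L M t k) * real L .. (of_int (type_index L M t k) + 1) * real L}"

text \<open>
  List positions start at 0, so \<open>w ! j\<close> is the letter number \<open>j + 1\<close>, weighted by \<open>L\<close> to the power
  \<open>1 - (j + 1)\<close>.
\<close>

definition type_cylinder ::
    "nat \<Rightarrow> nat \<Rightarrow> (nat \<Rightarrow> nat) \<Rightarrow> nat \<Rightarrow> nat list \<Rightarrow> real set" where
  "type_cylinder L M t k w =
     (let c = of_int (type_index L M t k) * real L + (\<Sum>j<length w. real (w ! j) / real L ^ j)
      in {c .. c + real L / real L ^ length w})"

definition type_matrix :: "nat \<Rightarrow> nat \<Rightarrow> (nat \<Rightarrow> nat) \<Rightarrow> nat \<Rightarrow> nat mat" where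
  "type_matrix L M t a = mat (num_types L M t) (num_types L M t)
     (\<lambda>(l, k).
        if \<exists>i<num_distinct M t.
             distinct_map L M t i ` basic_type L M t k = type_cylinder L M t l [a]
        then multiplicity_of L M t (THE i. i < num_distinct M t \<and>
               distinct_map L M t i ` basic_type L M t k = type_cylinder L M t l [a])
        else 0)"

definition type_matrix_word :: "nat \<Rightarrow> nat \<Rightarrow> (nat \<Rightarrow> nat) \<Rightarrow> nat list \<Rightarrow> nat mat" where
  "type_matrix_word L M t w =
     foldr (\<lambda>a B. type_matrix L M t a * B) w (1\<^sub>m (num_types L M t))"

definition column_sum :: "nat \<Rightarrow> nat \<Rightarrow> (nat \<Rightarrow> nat) \<Rightarrow> nat \<Rightarrow> nat \<Rightarrow> nat" where
  "column_sum L M t a j = (\<Sum>i<num_types L M t. type_matrix L M t a $$ (i, j))"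

end

theory Submission
  imports Defs
begin

text \<open>
  Write \<open>J u = [u L, (u + 1) L]\<close>.  A word \<open>w\<close> of length \<open>n\<close> maps \<open>J v\<close> onto a cylinder of level \<open>n\<close> of
  \<open>J u\<close> exactly when an integer recursion started at \<open>u\<close> ends in \<open>v\<close>.  Suppose that, for a cylinder \<open>C\<close> of
  level \<open>n\<close> and for every type \<open>v\<close>, at least \<open>k\<close> surviving words map \<open>J v\<close> onto \<open>C\<close>.  By the column sum
  condition, for every subcylinder of \<open>C\<close> and every type, the expected number of such words at
  level \<open>n + 1\<close> is at least \<open>r k\<close> with a fixed \<open>r > 1\<close>.  Hoeffding's inequality and a union bound over the
  boundedly many types and the at most exponentially many cylinders show that, once \<open>k\<close> is large, all these
  counts keep growing at every level with positive probability, and then a whole cylinder is covered.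
  The word with the positive row, extended by zeros, provides arbitrarily large initial counts.

  Positive probability is upgraded by branching: the probability \<open>q\<close> that no surviving
  word has a good subtree satisfies \<open>q \<le> 1 - p + p q\<^sup>M\<close> and \<open>q < 1\<close>, and it is at least the extinction
  probability \<open>e = 1 - p + p e\<^sup>M\<close>; by convexity \<open>q = e\<close>.
\<close>

section \<open>Words, cylinders and digit expansions\<close>

text \<open>
  Unlike in \<^const>\<open>surviving\<close>, the empty word carries a label here: then the labels of the
  subtree below any word have the same law as the whole tree.
\<close>

definition alive :: "(nat list \<Rightarrow> bool) \<Rightarrow> nat list \<Rightarrow> bool" where
  "alive x w \<longleftrightarrow> (\<forall>k\<le>length w. x (take k w))"

lemma alive_Nil [simp]: "alive x [] \<longleftrightarrow> x []"
  by (simp add: alive_def)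

lemma alive_append: "alive x (w @ v) \<longleftrightarrow> alive x w \<and> alive (\<lambda>v. x (w @ v)) v"
proof safe
  assume *: "alive x (w @ v)"
  show "alive x w"
    unfolding alive_def
  proof safe
    fix k assume "k \<le> length w"
    then show "x (take k w)" using * unfolding alive_def by (auto dest!: spec[of _ k])
  qed
  show "alive (\<lambda>v. x (w @ v)) v"
    unfolding alive_def
  proof safe
    fix k assume "k \<le> length v"
    then show "x (w @ take k v)"
      using * unfolding alive_def by (auto dest!: spec[of _ "length w + k"])
  qed
next
  assume *: "alive x w" "alive (\<lambda>v. x (w @ v)) v"
  show "alive x (w @ v)"
    unfolding alive_def
  proof safe
    fix k assume k: "k \<le> length (w @ v)"
    show "x (take k (w @ v))"
    proof (cases "k \<le> length w")
      case True
      then show ?thesis using * by (simp add: alive_def)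
    next
      case False
      then have "x (w @ take (k - length w) v)"
        using * k unfolding alive_def by auto
      with False show ?thesis by simp
    qed
  qed
qed

lemma alive_Cons: "alive x (i # w) \<longleftrightarrow> x [] \<and> alive (\<lambda>v. x (i # v)) w"
proof -
  have "alive x ([i] @ w) \<longleftrightarrow> alive x [i] \<and> alive (\<lambda>v. x ([i] @ v)) w"
    by (rule alive_append)
  moreover have "alive x [i] \<longleftrightarrow> x [] \<and> x [i]"
    by (auto simp: alive_def le_Suc_eq)
  moreover have "x [i]" if "alive (\<lambda>v. x (i # v)) w"
    using that by (auto simp: alive_def dest!: spec[of _ 0])
  ultimately show ?thesis by auto
qed

lemma alive_snoc: "alive x (w @ [i]) \<longleftrightarrow> alive x w \<and> x (w @ [i])"
  unfolding alive_append[of x w "[i]"] alive_Cons by (auto simp: alive_def)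

lemma alive_take: "alive x w \<Longrightarrow> alive x (take n w)"
  using alive_append[of x "take n w" "drop n w"] by simp

lemma alive_cong: "(\<And>k. k \<le> length w \<Longrightarrow> x (take k w) = y (take k w)) \<Longrightarrow> alive x w = alive y w"
  by (auto simp: alive_def)

lemma words_simps [simp]:
  "[] \<in> words k" "i # w \<in> words k \<longleftrightarrow> i < k \<and> w \<in> words k"
  "w @ v \<in> words k \<longleftrightarrow> w \<in> words k \<and> v \<in> words k"
  by (auto simp: words_def)

lemma take_words: "w \<in> words k \<Longrightarrow> take n w \<in> words k"
  by (auto simp: words_def dest: in_set_takeD)

lemma finite_words_length: "finite {w \<in> words k. length w = n}"
  and card_words_length: "card {w \<in> words k. length w = n} = k ^ n"
proof -
  have "{w \<in> words k. length w = n} = {w. set w \<subseteq> {..<k} \<and> length w = n}"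
    by (auto simp: words_def)
  then show "finite {w \<in> words k. length w = n}" "card {w \<in> words k. length w = n} = k ^ n"
    by (simp_all add: finite_lists_length_eq card_lists_length_eq)
qed

lemma finite_words_length_le: "finite {w \<in> words k. length w \<le> n}"
proof -
  have "{w \<in> words k. length w \<le> n} = {w. set w \<subseteq> {..<k} \<and> length w \<le> n}"
    by (auto simp: words_def)
  then show ?thesis by (simp add: finite_lists_length_le)
qed

section \<open>Images of basic intervals under words\<close>

lemma ifs_word_simps [simp]:
  "ifs_word L t [] y = y" "ifs_word L t (i # w) y = ifs_word L t w y / real L + real (t i)"
  by (simp_all add: ifs_word_def ifs_map_def)

lemma ifs_word_append: "ifs_word L t (w @ v) y = ifs_word L t w (ifs_word L t v y)"
  by (induction w) auto

text \<open>Horner form of the sum of a_j L^(1-j), which is the offset of the left end of a cylinder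
  from the left end of its basic interval.\<close>

fun radix :: "nat \<Rightarrow> nat list \<Rightarrow> real" where
  "radix L [] = 0"
| "radix L (a # w) = real a + radix L w / real L"

lemma radix_snoc: "radix L (w @ [a]) = radix L w + real a / real L ^ length w"
  by (induction w) (auto simp: add_divide_distrib)

text \<open>
  Writing \<open>J u\<close> for the interval \<open>[u L, (u + 1) L]\<close> and \<open>J u w\<close> for its cylinder at \<open>w\<close>,
  \<open>track L t u w v\<close> is the integer \<open>u'\<close> such that \<open>f\<^sub>v\<close> maps \<open>J u'\<close> onto \<open>J u w\<close>, for words \<open>v\<close>
  and \<open>w\<close> of the same length.
\<close>

fun track :: "nat \<Rightarrow> (nat \<Rightarrow> nat) \<Rightarrow> int \<Rightarrow> nat list \<Rightarrow> nat list \<Rightarrow> int" where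
  "track L t u (a # w) (i # v) = track L t (u * int L + int a - int (t i)) w v"
| "track L t u _ _ = u"

lemma track_snoc:
  "length w = length v \<Longrightarrow>
    track L t u (w @ [a]) (v @ [i]) = track L t u w v * int L + int a - int (t i)"
  by (induction L t u w v rule: track.induct) auto

text \<open>One step of \<open>track\<close> solves u' + t_i = u L + a for u'; under this condition
  the left end of the image of \<open>J u'\<close> under f_i and that of the subcylinder agree. The
  induction rescales this by 1/L.\<close>

lemma ifs_word_track:
  assumes "length w = length v" "L \<noteq> 0"
  shows "ifs_word L t v (of_int (track L t u w v) * real L + s) =
    of_int u * real L + radix L w + s / real L ^ length w"
  using assms
  by (induction L t u w v rule: track.induct) (auto simp: field_simps)

text \<open>The remainder ranges over the closed interval [0, L], so that both ends of a cylinder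
  are included.\<close>

lemma expand_radix:
  assumes "L \<noteq> 0" "0 \<le> s" "s \<le> real L"
  shows "\<exists>w\<in>words L. length w = n \<and> (\<exists>s'\<in>{0..real L}. s = radix L w + s' / real L ^ n)"
proof (induction n)
  case 0
  then show ?case using assms by (intro bexI[of _ "[]"]) auto
next
  case (Suc n)
  then obtain w s' where w: "w \<in> words L" "length w = n"
    and s': "0 \<le> s'" "s' \<le> real L" "s = radix L w + s' / real L ^ n"
    by auto
  \<comment> \<open>The cap at L - 1 treats the right end s' = L, where the floor is not a
    digit.\<close>
  define a where "a = min (nat \<lfloor>s'\<rfloor>) (L - 1)"
  have a: "a < L" "real a \<le> s'" "s' \<le> real a + 1"
    using assms s' unfolding a_def by linarith+
  show ?case
  proof (intro bexI[of _ "w @ [a]"] conjI bexI[of _ "(s' - real a) * real L"])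
    show "s = radix L (w @ [a]) + (s' - real a) * real L / real L ^ Suc n"
      using assms w by (simp add: radix_snoc s' field_simps)
    show "(s' - real a) * real L \<in> {0..real L}"
      using a assms by (auto intro: mult_left_le_one_le)
  qed (use w a in auto)
qed

lemma radix_append:
  "radix L (w @ v) = radix L w + radix L v / real L ^ length w"
  by (induction w) (auto simp: add_divide_distrib)

section \<open>Points and intervals covered at every level\<close>

definition covered :: "nat \<Rightarrow> nat \<Rightarrow> (nat \<Rightarrow> nat) \<Rightarrow> (nat list \<Rightarrow> bool) \<Rightarrow> real \<Rightarrow> bool" where
  "covered L M t x z \<longleftrightarrow> (\<forall>n. \<exists>w\<in>words M. length w = n \<and> alive x w \<and>
     z \<in> ifs_word L t w ` base_interval L M t)"

definition covers_interval :: "nat \<Rightarrow> nat \<Rightarrow> (nat \<Rightarrow> nat) \<Rightarrow> (nat list \<Rightarrow> bool) \<Rightarrow> bool" where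
  "covers_interval L M t x \<longleftrightarrow> (\<exists>c d. c < d \<and> (\<forall>z\<in>{c..d}. covered L M t x z))"

text \<open>\<open>K\<close> is the quotient t_(M-1) / (L - 1). The base interval is therefore
  [0, K L], which for K > 0 is made up of the intervals \<open>J u\<close> with 0 <= u < K.\<close>

locale integer_ifs =
  fixes L M K :: nat and t :: "nat \<Rightarrow> nat"
  assumes L_ge_2: "L \<ge> 2"
    and t_le: "i < M \<Longrightarrow> t i \<le> t (M - 1)"
    and t_max: "t (M - 1) = K * (L - 1)"
begin

lemma base_interval_eq: "base_interval L M t = {0..real K * real L}"
proof -
  have "real (t (M - 1)) = real K * (real L - 1)"
    unfolding t_max using L_ge_2 by (simp add: of_nat_diff)
  then show ?thesis
    unfolding base_interval_def using L_ge_2 by simp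
qed

text \<open>Each letter adds t_i <= K (L - 1) to y / L <= K, so the sum is at most K L.\<close>

lemma ifs_word_base_interval:
  "w \<in> words M \<Longrightarrow> ifs_word L t w ` base_interval L M t \<subseteq> base_interval L M t"
proof (induction w)
  case Nil
  then show ?case by simp
next
  case (Cons i w)
  have ti: "real (t i) \<le> real K * (real L - 1)"
  proof -
    have "t i \<le> K * (L - 1)" using Cons.prems t_le t_max by (metis words_simps(2))
    then have "real (t i) \<le> real (K * (L - 1))" by (simp only: of_nat_le_iff)
    then show ?thesis using L_ge_2 by (simp add: of_nat_diff)
  qed
  show ?case
  proof
    fix z assume "z \<in> ifs_word L t (i # w) ` base_interval L M t"
    then obtain y where y: "y \<in> ifs_word L t w ` base_interval L M t" "z = y / real L + real (t i)"
      by auto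
    then have "0 \<le> y" "y \<le> real K * real L"
      using Cons by (auto simp: base_interval_eq)
    then have "0 \<le> y / real L" "y / real L \<le> real K"
      using L_ge_2 by (auto simp: field_simps)
    then show "z \<in> base_interval L M t"
      using ti unfolding y base_interval_eq by (auto simp: algebra_simps)
  qed
qed

text \<open>The images of the base interval shrink along prefixes, so truncating alive words of
  large length settles the lower levels.\<close>

lemma coveredI:
  assumes "\<And>n. n \<ge> n0 \<Longrightarrow> \<exists>w\<in>words M. length w = n \<and> alive x w \<and>
     z \<in> ifs_word L t w ` base_interval L M t"
  shows "covered L M t x z"
  unfolding covered_def
proof
  fix n
  obtain w where w: "w \<in> words M" "length w = max n n0" "alive x w"
      "z \<in> ifs_word L t w ` base_interval L M t"
    using assms[of "max n n0"] by auto
  obtain y where y: "y \<in> base_interval L M t" "z = ifs_word L t w y"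
    using w by auto
  have "z = ifs_word L t (take n w) (ifs_word L t (drop n w) y)"
    unfolding y by (subst ifs_word_append[symmetric]) simp
  moreover have "ifs_word L t (drop n w) y \<in> base_interval L M t"
  proof -
    have "drop n w \<in> words M" using w(1) by (auto simp: words_def dest: in_set_dropD)
    then show ?thesis using ifs_word_base_interval y by blast
  qed
  ultimately show "\<exists>w\<in>words M. length w = n \<and> alive x w \<and> z \<in> ifs_word L t w ` base_interval L M t"
    using w by (intro bexI[of _ "take n w"]) (auto simp: take_words alive_take)
qed

lemma covered_Cons:
  assumes "x []" "i < M" "covered L M t (\<lambda>v. x (i # v)) z"
  shows "covered L M t x (z / real L + real (t i))"
proof (rule coveredI[of 1])
  fix n :: nat assume n: "n \<ge> 1"
  obtain w y where w: "w \<in> words M" "length w = n - 1" "alive (\<lambda>v. x (i # v)) w"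
    "z = ifs_word L t w y" "y \<in> base_interval L M t"
    using assms(3) unfolding covered_def by blast
  then show "\<exists>w\<in>words M. length w = n \<and> alive x w \<and>
      z / real L + real (t i) \<in> ifs_word L t w ` base_interval L M t"
    using n assms by (intro bexI[of _ "i # w"]) (auto simp: alive_Cons)
qed

lemma covers_interval_Cons:
  assumes "x []" "i < M" "covers_interval L M t (\<lambda>v. x (i # v))"
  shows "covers_interval L M t x"
proof -
  obtain c d where cd: "c < d" and cov: "\<And>z. z \<in> {c..d} \<Longrightarrow> covered L M t (\<lambda>v. x (i # v)) z"
    using assms unfolding covers_interval_def by blast
  have L: "real L > 0" using L_ge_2 by simp
  show ?thesis
    unfolding covers_interval_def
  proof (intro exI conjI ballI)
    show "c / real L + real (t i) < d / real L + real (t i)"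
      using cd L by (simp add: divide_strict_right_mono)
    fix z assume z: "z \<in> {c / real L + real (t i)..d / real L + real (t i)}"
    have "covered L M t x ((z - real (t i)) * real L / real L + real (t i))"
      using z L by (intro covered_Cons assms cov) (auto simp: field_simps)
    then show "covered L M t x z" using L by simp
  qed
qed

text \<open>The maps are affine with positive slope, so an interval found in the subtree below an
  alive word is carried back to one for the whole tree.\<close>

lemma covers_interval_append:
  "alive x w \<Longrightarrow> w \<in> words M \<Longrightarrow> covers_interval L M t (\<lambda>v. x (w @ v)) \<Longrightarrow> covers_interval L M t x"
proof (induction w arbitrary: x)
  case Nil
  then show ?case by simp
next
  case (Cons i w)
  show ?case
    by (rule covers_interval_Cons[of _ i]) (use Cons in \<open>auto simp: alive_Cons\<close>)
qed

end

text \<open>Abstracts the hypotheses from the self-similar measure: \<open>T\<close> stands for the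
  indices of the basic types, the cardinality in \<open>growth\<close> is a column sum, and
  \<open>reach\<close> is the positive row of a matrix word, read along
  \<open>track\<close>.\<close>

locale typed_ifs = integer_ifs +
  fixes T :: "int set" and u0 :: int and p :: real
  assumes finite_T: "finite T"
    and p: "0 < p" "p < 1"
    and growth: "v \<in> T \<Longrightarrow> a < L \<Longrightarrow>
      1 < p * real (card {(u, i). u \<in> T \<and> i < M \<and> v + int (t i) = u * int L + int a})"
    and u0_in_T: "u0 \<in> T"
    and reach: "\<exists>b\<in>words L. \<forall>v\<in>T. \<exists>w\<in>words M. length w = length b \<and> track L t u0 b w = v"
begin

text \<open>These are the pairs (u, i) for which f_i maps \<open>J v\<close> onto the level-one
  cylinder of \<open>J u\<close> with digit a: a path that has arrived at u continues by the letter
  i to v.\<close>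

definition parents :: "nat \<Rightarrow> int \<Rightarrow> (int \<times> nat) set" where
  "parents a v = {(u, i). u \<in> T \<and> i < M \<and> v + int (t i) = u * int L + int a}"

lemma finite_parents: "finite (parents a v)"
  by (rule finite_subset[of _ "T \<times> {..<M}"]) (auto simp: parents_def finite_T)

lemma card_parents: "v \<in> T \<Longrightarrow> a < L \<Longrightarrow> 1 < p * real (card (parents a v))"
  using growth unfolding parents_def by auto

text \<open>As p < 1, the growth condition forces the number of parents to exceed 1.\<close>

lemma card_parents_ge_2:
  assumes "v \<in> T" "a < L"
  shows "2 \<le> card (parents a v)"
proof -
  have "1 < p * real (card (parents a v))" using card_parents assms by blast
  also have "\<dots> \<le> 1 * real (card (parents a v))" using p by (intro mult_right_mono) auto
  finally show ?thesis by simp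
qed

text \<open>With at most one map, the equation v + t_i = u L + a leaves at most one parent.\<close>

lemma M_ge_2: "M \<ge> 2"
proof (rule ccontr)
  assume "\<not> ?thesis"
  then have M: "M \<le> 1" by simp
  have "parents 0 u0 \<subseteq> {((u0 + int (t 0)) div int L, 0)}"
  proof
    fix z assume "z \<in> parents 0 u0"
    then obtain u i where z: "z = (u, i)" "i < M" "u0 + int (t i) = u * int L"
      by (auto simp: parents_def)
    then have "i = 0" using M by simp
    with z show "z \<in> {((u0 + int (t 0)) div int L, 0)}" using L_ge_2 by simp
  qed
  from card_mono[OF _ this] card_parents_ge_2[OF u0_in_T, of 0] L_ge_2 show False
    by simp
qed

lemma parent_ex: "v \<in> T \<Longrightarrow> a < L \<Longrightarrow> \<exists>u i. u \<in> T \<and> i < M \<and> v + int (t i) = u * int L + int a"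
proof -
  assume "v \<in> T" "a < L"
  then have "parents a v \<noteq> {}" using card_parents_ge_2[of v a] by auto
  then show ?thesis by (auto simp: parents_def)
qed

text \<open>
  Passing from \<open>v\<close> to a suitable parent (with digit \<open>0\<close> if \<open>v < 0\<close>, with digit \<open>L - 1\<close> if \<open>v \<ge> K\<close>)
  strictly decreases the distance to \<open>[0, K - 1]\<close>.
\<close>

lemma T_meets_base: "\<exists>v\<in>T. 0 \<le> v \<and> v < int K"
proof (rule ccontr)
  assume none: "\<not> ?thesis"
  define d where "d v = nat (if v < 0 then - v else v - int K + 1)" for v
  obtain v where v: "v \<in> T" and min: "\<And>u. u \<in> T \<Longrightarrow> d v \<le> d u"
    using ex_has_least_nat[of "\<lambda>v. v \<in> T" u0 d] u0_in_T by blast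
  have tK: "int (t i) \<le> int K * (int L - 1)" if "i < M" for i
  proof -
    have "t i \<le> K * (L - 1)" using that t_le t_max by metis
    then have "int (t i) \<le> int (K * (L - 1))" by (simp only: of_nat_le_iff)
    then show ?thesis using L_ge_2 by (simp add: of_nat_diff)
  qed
  show False
  proof (cases "v < 0")
    case True
    obtain u i where u: "u \<in> T" "i < M" "v + int (t i) = u * int L"
      using parent_ex[OF v, of 0] L_ge_2 by auto
    have "u * int L \<le> -1 + int K * (int L - 1)" using tK[OF u(2)] True u(3) by linarith
    then have "u * int L < int K * int L" by (simp add: algebra_simps)
    then have "u < int K" using L_ge_2 by simp
    \<comment> \<open>No index of \<open>T\<close> lies in [0, K), so u < K leaves only u < 0. Then
      v <= u L <= 2 u puts u at most half as far below 0 as v.\<close>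
    then have "u < 0" using none u(1) by force
    then have "u * int L \<le> u * 2" using L_ge_2 by (intro mult_left_mono_neg) auto
    moreover have "u * int L \<ge> v" using u(3) by simp
    ultimately have "v \<le> u * 2" by linarith
    then have "d u < d v" using True \<open>u < 0\<close> by (auto simp: d_def)
    then show False using min[OF u(1)] by simp
  next
    case False
    then have vK: "v \<ge> int K" using none v by force
    obtain u i where u: "u \<in> T" "i < M" "v + int (t i) = u * int L + int (L - 1)"
      using parent_ex[OF v, of "L - 1"] L_ge_2 by auto
    have eq: "u * int L = v + int (t i) - int L + 1" using u(3) L_ge_2 by (simp add: of_nat_diff)
    have "u * int L > (-1) * int L" using eq vK by simp
    then have u0: "u > -1" using L_ge_2 by (subst (asm) mult_less_cancel_right) auto
    then have uK: "u \<ge> int K" using none u(1) by force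
    have "(u - int K + 1) * int L \<le> v - int K + 1"
      using eq tK[OF u(2)] by (simp add: algebra_simps)
    moreover have "(u - int K + 1) * 2 \<le> (u - int K + 1) * int L"
      using uK L_ge_2 by (intro mult_left_mono) auto
    ultimately have "d u < d v" using uK u0 False by (auto simp: d_def)
    then show False using min[OF u(1)] by simp
  qed
qed

section \<open>Counting the paths into a cylinder\<close>

definition extensions :: "nat list set \<Rightarrow> nat list \<Rightarrow> nat \<Rightarrow> int \<Rightarrow> nat list set" where
  "extensions S w a v = (\<lambda>((u, i), s). s @ [i]) `
     (SIGMA (u, i) : parents a v. {s \<in> S. track L t u0 w s = u})"

lemma extensionsD:
  assumes "s' \<in> extensions S w a v" "\<And>s. s \<in> S \<Longrightarrow> length s = length w"
  shows "\<exists>s\<in>S. \<exists>i<M. s' = s @ [i] \<and> track L t u0 (w @ [a]) s' = v"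
  using assms by (fastforce simp: extensions_def parents_def track_snoc)

text \<open>An extension determines its last letter, its prefix and, through \<open>track\<close>,
  the parent type of that prefix. Hence the contributions of different parents are disjoint and
  their sizes add up.\<close>

lemma card_extensions:
  assumes "finite S" and m: "\<And>u. u \<in> T \<Longrightarrow> m \<le> real (card {s \<in> S. track L t u0 w s = u})"
  shows "m * real (card (parents a v)) \<le> real (card (extensions S w a v))"
proof -
  have "inj_on (\<lambda>((u, i), s). s @ [i]) (SIGMA (u, i) : parents a v. {s \<in> S. track L t u0 w s = u})"
    by (auto simp: inj_on_def)
  then have "card (extensions S w a v) =
      (\<Sum>(u, i)\<in>parents a v. card {s \<in> S. track L t u0 w s = u})"
    unfolding extensions_def using finite_parents assms(1)
    by (subst card_image) (auto simp: card_SigmaI case_prod_unfold)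
  also have "real \<dots> = (\<Sum>(u, i)\<in>parents a v. real (card {s \<in> S. track L t u0 w s = u}))"
    by (simp add: case_prod_unfold)
  also have "\<dots> \<ge> (\<Sum>(u, i)\<in>parents a v. m)"
    using m by (intro sum_mono) (auto simp: parents_def)
  finally show ?thesis by (simp add: mult.commute)
qed

lemma finite_extensions: "finite S \<Longrightarrow> finite (extensions S w a v)"
  unfolding extensions_def using finite_parents
  by (intro finite_imageI finite_SigmaI) auto

text \<open>Appending a zero to b at least doubles every count, since each type has at least two
  parents for the digit 0.\<close>

lemma many_paths:
  "\<exists>b\<in>words L. \<forall>v\<in>T. m \<le> card {w \<in> words M. length w = length b \<and> track L t u0 b w = v}"
proof -
  obtain b where b: "b \<in> words L"
    "\<And>v. v \<in> T \<Longrightarrow> \<exists>w\<in>words M. length w = length b \<and> track L t u0 b w = v"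
    using reach by blast
  have "\<exists>b'\<in>words L. \<forall>v\<in>T. 2 ^ n \<le> card {w \<in> words M. length w = length b' \<and> track L t u0 b' w = v}" for n
  proof (induction n)
    case 0
    have "1 \<le> card {w \<in> words M. length w = length b \<and> track L t u0 b w = v}" if "v \<in> T" for v
    proof -
      have "finite {w \<in> words M. length w = length b \<and> track L t u0 b w = v}"
        by (rule finite_subset[OF _ finite_words_length]) auto
      then show ?thesis using b(2)[OF that] by (auto simp: Suc_le_eq card_gt_0_iff)
    qed
    then show ?case using b(1) by auto
  next
    case (Suc n)
    then obtain b' where b': "b' \<in> words L"
      "\<And>v. v \<in> T \<Longrightarrow> 2 ^ n \<le> card {w \<in> words M. length w = length b' \<and> track L t u0 b' w = v}"
      by blast
    define S where "S = {w \<in> words M. length w = length b'}"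
    have S: "finite S" unfolding S_def by (rule finite_words_length)
    show ?case
    proof (intro bexI[of _ "b' @ [0]"] ballI)
      fix v assume v: "v \<in> T"
      have S': "{s \<in> S. track L t u0 b' s = u} =
          {w \<in> words M. length w = length b' \<and> track L t u0 b' w = u}" for u
        by (auto simp: S_def)
      have "real (2 ^ n) * real (card (parents 0 v)) \<le> real (card (extensions S b' 0 v))"
        using b'(2) by (intro card_extensions S) (simp only: S' of_nat_le_iff)
      moreover have "real (2 ^ n) * 2 \<le> real (2 ^ n) * real (card (parents 0 v))"
        using card_parents_ge_2[OF v, of 0] L_ge_2 by (intro mult_left_mono) auto
      moreover have "real (2 ^ Suc n) = real (2 ^ n) * 2"
        by simp
      ultimately have "real (2 ^ Suc n) \<le> real (card (extensions S b' 0 v))"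
        by linarith
      then have "2 ^ Suc n \<le> card (extensions S b' 0 v)"
        by (simp only: of_nat_le_iff)
      also have "\<dots> \<le> card {w \<in> words M. length w = length (b' @ [0]) \<and> track L t u0 (b' @ [0]) w = v}"
      proof (rule card_mono)
        show "finite {w \<in> words M. length w = length (b' @ [0]) \<and> track L t u0 (b' @ [0]) w = v}"
          by (rule finite_subset[OF _ finite_words_length]) auto
        show "extensions S b' 0 v \<subseteq> {w \<in> words M. length w = length (b' @ [0]) \<and> track L t u0 (b' @ [0]) w = v}"
          using extensionsD[of _ S b' 0 v] by (fastforce simp: S_def)
      qed
      finally show "2 ^ Suc n \<le> card {w \<in> words M. length w = length (b' @ [0]) \<and>
          track L t u0 (b' @ [0]) w = v}" .
    qed (use b'(1) L_ge_2 in auto)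
  qed
  from this[of m] show ?thesis
    using less_exp[of m] by (meson less_imp_le order_trans)
qed

text \<open>Each point of the cylinder of b lies in some subcylinder of every deeper level, and an
  alive word maps a basic interval inside the base interval onto that subcylinder. So the whole
  cylinder of b is covered.\<close>

lemma covers_interval_if_tracked:
  assumes b: "b \<in> words L"
    and tracked: "\<And>a v. a \<in> words L \<Longrightarrow> v \<in> T \<Longrightarrow> \<exists>w\<in>words M. length w = length b + length a \<and>
      alive x w \<and> track L t u0 (b @ a) w = v"
  shows "covers_interval L M t x"
proof -
  \<comment> \<open>One type serves for all levels: \<open>J v\<close> lies in the base interval, so
    images of \<open>J v\<close> lie in images of the base interval.\<close>
  obtain v where v: "v \<in> T" "0 \<le> v" "v < int K"
    using T_meets_base by blast
  define c where "c = of_int u0 * real L + radix L b"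
  have L: "real L > 0" using L_ge_2 by simp
  show ?thesis
    unfolding covers_interval_def
  proof (intro exI conjI ballI)
    show "c < c + real L / real L ^ length b" using L by simp
    fix z assume z: "z \<in> {c..c + real L / real L ^ length b}"
    show "covered L M t x z"
    proof (rule coveredI[of "length b"])
      fix n assume n: "n \<ge> length b"
      \<comment> \<open>This is the position of z within the cylinder of b, rescaled to [0, L]; its
        digits continue b to a level n cylinder around z.\<close>
      define s where "s = (z - c) * real L ^ length b"
      have s: "0 \<le> s" "s \<le> real L" using z L by (auto simp: s_def field_simps)
      obtain a s' where a: "a \<in> words L" "length a = n - length b" "0 \<le> s'" "s' \<le> real L"
          "s = radix L a + s' / real L ^ (n - length b)"
        using expand_radix[OF _ s, of "n - length b"] L by auto
      have len: "length (b @ a) = n" using a n by simp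
      obtain w where w: "w \<in> words M" "length w = n" "alive x w" "track L t u0 (b @ a) w = v"
        using tracked[OF a(1) v(1)] len by auto
      have "ifs_word L t w (of_int v * real L + s') =
          of_int u0 * real L + radix L (b @ a) + s' / real L ^ n"
        using ifs_word_track[of "b @ a" w L t u0 s'] w len L_ge_2 by simp
      also have "\<dots> = c + s / real L ^ length b"
      proof -
        have "real L ^ n = real L ^ (n - length b) * real L ^ length b"
          using n by (simp flip: power_add)
        then show ?thesis
          by (simp add: a(5) c_def radix_append add_divide_distrib)
      qed
      also have "\<dots> = z" using L by (simp add: s_def)
      finally have "z = ifs_word L t w (of_int v * real L + s')" by simp
      moreover have "of_int v * real L + s' \<in> base_interval L M t"
      proof -
        have "of_int v + 1 \<le> real K" using v(3) by linarith
        then have "(of_int v + 1) * real L \<le> real K * real L" by (intro mult_right_mono) auto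
        then show ?thesis using v a L by (auto simp: base_interval_eq algebra_simps)
      qed
      ultimately show "\<exists>w\<in>words M. length w = n \<and> alive x w \<and>
          z \<in> ifs_word L t w ` base_interval L M t"
        using w by blast
    qed
  qed
qed

end

section \<open>Independent coins\<close>

text \<open>The canonical model of the labels: passing to a subtree becomes a reindexing of
  coordinates.\<close>

definition coins :: "real \<Rightarrow> ('i \<Rightarrow> bool) measure" where
  "coins p = PiM UNIV (\<lambda>_. measure_pmf (bernoulli_pmf p))"

text \<open>Takes the place of measurability with respect to the coordinates in
  \<open>K\<close>.\<close>

definition depends_on :: "(('i \<Rightarrow> bool) \<Rightarrow> bool) \<Rightarrow> 'i set \<Rightarrow> bool" where
  "depends_on \<Phi> K \<longleftrightarrow> (\<forall>x y. (\<forall>i\<in>K. x i = y i) \<longrightarrow> \<Phi> x = \<Phi> y)"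

lemma depends_onI: "(\<And>x y. (\<And>i. i \<in> K \<Longrightarrow> x i = y i) \<Longrightarrow> \<Phi> x = \<Phi> y) \<Longrightarrow> depends_on \<Phi> K"
  unfolding depends_on_def by blast

lemma depends_onD: "depends_on \<Phi> K \<Longrightarrow> (\<And>i. i \<in> K \<Longrightarrow> x i = y i) \<Longrightarrow> \<Phi> x = \<Phi> y"
  unfolding depends_on_def by blast

section \<open>Measurability and laws of coordinates\<close>

lemma prob_space_coins: "prob_space (coins p)"
  unfolding coins_def by (intro prob_space_PiM) (rule prob_space_measure_pmf)

lemma space_coins [simp]: "space (coins p) = UNIV"
  by (simp add: coins_def space_PiM)

lemma sets_coins: "sets (coins p) = sets (PiM UNIV (\<lambda>_. count_space UNIV))"
  unfolding coins_def by (intro sets_PiM_cong) auto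

lemma measurable_coins_iff:
  fixes f :: "'a \<Rightarrow> 'i \<Rightarrow> bool"
  shows "f \<in> measurable N (coins p) \<longleftrightarrow> (\<forall>i. (\<lambda>x. f x i) \<in> measurable N (count_space UNIV))"
proof -
  have "measurable N (coins p :: ('i \<Rightarrow> bool) measure) = measurable N (PiM UNIV (\<lambda>_. count_space UNIV))"
    by (intro measurable_cong_sets refl sets_coins)
  moreover have "f \<in> measurable N (PiM UNIV (\<lambda>_. count_space UNIV)) \<longleftrightarrow>
      (\<forall>i. (\<lambda>x. f x i) \<in> measurable N (count_space UNIV))"
  proof
    assume f: "f \<in> measurable N (PiM UNIV (\<lambda>_. count_space UNIV))"
    show "\<forall>i. (\<lambda>x. f x i) \<in> measurable N (count_space UNIV)"
      using measurable_compose[OF f measurable_component_singleton] by blast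
  next
    assume "\<forall>i. (\<lambda>x. f x i) \<in> measurable N (count_space UNIV)"
    then show "f \<in> measurable N (PiM UNIV (\<lambda>_. count_space UNIV))"
      by (intro measurable_PiM_single') auto
  qed
  ultimately show ?thesis by (simp only:)
qed

lemma measurable_coins_component [measurable]:
  fixes i :: 'i
  shows "(\<lambda>x. x i) \<in> measurable (coins p) (count_space UNIV)"
  using measurable_ident[of "coins p :: ('i \<Rightarrow> bool) measure"] unfolding measurable_coins_iff id_def by blast

lemma measurable_coins_reindex [measurable]:
  "(\<lambda>x v. x (f v)) \<in> measurable (coins p) (coins p)"
  unfolding measurable_coins_iff by auto

lemma measurable_coins_override [measurable]:
  "(\<lambda>y. override_on y x F) \<in> measurable (coins p) (coins p)"
  unfolding measurable_coins_iff override_on_def by auto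

text \<open>The event is a finite union of cylinder events, one for each pattern of values on F that
  satisfies it.\<close>

lemma pred_finite_support:
  assumes "finite F" "depends_on \<Phi> F"
  shows "Measurable.pred (coins p) \<Phi>"
proof -
  have "\<Phi> = (\<lambda>x. \<exists>S\<in>{S\<in>Pow F. \<Phi> (\<lambda>i. i \<in> S)}. \<forall>i\<in>F. x i = (i \<in> S))"
  proof (intro ext iffI)
    fix x assume "\<Phi> x"
    moreover have "\<Phi> x = \<Phi> (\<lambda>i. i \<in> {i \<in> F. x i})"
      by (rule depends_onD[OF assms(2)]) auto
    ultimately show "\<exists>S\<in>{S\<in>Pow F. \<Phi> (\<lambda>i. i \<in> S)}. \<forall>i\<in>F. x i = (i \<in> S)"
      by (intro bexI[of _ "{i \<in> F. x i}"]) auto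
  next
    fix x assume "\<exists>S\<in>{S\<in>Pow F. \<Phi> (\<lambda>i. i \<in> S)}. \<forall>i\<in>F. x i = (i \<in> S)"
    then obtain S where "\<Phi> (\<lambda>i. i \<in> S)" "\<forall>i\<in>F. x i = (i \<in> S)" by blast
    with depends_onD[OF assms(2), of x "\<lambda>i. i \<in> S"] show "\<Phi> x" by auto
  qed
  moreover have "Measurable.pred (coins p) (\<lambda>x. \<exists>S\<in>{S\<in>Pow F. \<Phi> (\<lambda>i. i \<in> S)}. \<forall>i\<in>F. x i = (i \<in> S))"
    using assms(1) by (intro pred_intros_finite) auto
  ultimately show ?thesis by (simp only:)
qed

text \<open>Injectivity keeps the selected coordinates distinct, hence independent. This makes the
  subtree below any word a copy of the whole tree in law.\<close>

lemma distr_coins_reindex: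
  assumes "inj f"
  shows "distr (coins p) (coins p) (\<lambda>x v. x (f v)) = coins p"
  using distr_PiM_reindex[of UNIV "\<lambda>_. measure_pmf (bernoulli_pmf p)" f UNIV] assms
  by (simp add: coins_def prob_space_measure_pmf restrict_def)

lemma prob_coins_reindex:
  assumes "inj f" "Measurable.pred (coins p) \<Phi>"
  shows "measure (coins p) {x. \<Phi> (\<lambda>v. x (f v))} = measure (coins p) {x. \<Phi> x}"
proof -
  have "{x. \<Phi> x} \<in> sets (coins p)"
    using assms(2) by (auto simp: pred_def)
  then have "measure (distr (coins p) (coins p) (\<lambda>x v. x (f v))) {x. \<Phi> x} =
      measure (coins p) {x. \<Phi> (\<lambda>v. x (f v))}"
    by (subst measure_distr) (auto simp: vimage_def)
  then show ?thesis by (simp add: distr_coins_reindex[OF assms(1)])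
qed

lemma distr_coins_component:
  "distr (coins p) (count_space UNIV) (\<lambda>x. x i) = measure_pmf (bernoulli_pmf p)"
proof -
  have "distr (coins p) (measure_pmf (bernoulli_pmf p)) (\<lambda>x. x i) = measure_pmf (bernoulli_pmf p)"
    unfolding coins_def by (intro distr_PiM_component) (auto simp: prob_space_measure_pmf)
  also have "distr (coins p) (measure_pmf (bernoulli_pmf p)) (\<lambda>x. x i) =
      distr (coins p) (count_space UNIV) (\<lambda>x. x i)"
    by (rule distr_cong) auto
  finally show ?thesis .
qed

lemma prob_coins_component:
  assumes "0 \<le> p" "p \<le> 1"
  shows "measure (coins p) {x. x i} = p"
proof -
  have "measure (coins p) {x. x i} = measure (distr (coins p) (count_space UNIV) (\<lambda>x. x i)) {True}"
    by (subst measure_distr) (auto simp: vimage_def)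
  also have "\<dots> = p"
    using assms by (simp add: distr_coins_component measure_pmf_single)
  finally show ?thesis .
qed

lemma indep_vars_coins:
  "prob_space.indep_vars (coins p) (\<lambda>_. count_space UNIV) (\<lambda>i x. x i) UNIV"
proof -
  interpret prob_space "coins p" by (rule prob_space_coins)
  have "distr (coins p) (PiM UNIV (\<lambda>_. count_space UNIV)) (\<lambda>x. \<lambda>i\<in>UNIV. x i) =
      distr (coins p) (coins p) (\<lambda>x. x)"
    by (intro distr_cong) (auto simp: sets_coins)
  then show ?thesis
    by (simp add: indep_vars_iff_distr_eq_PiM' distr_coins_component distr_id flip: coins_def)
qed

text \<open>Filling the coordinates outside \<open>K\<close> with \<open>False\<close> turns an
  event on all coins into one on the coins in \<open>K\<close>.\<close>

lemma pred_coins_restrict: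
  assumes "Measurable.pred (coins p) \<Phi>"
  shows "Measurable.pred (PiM K (\<lambda>_. count_space UNIV)) (\<lambda>y. \<Phi> (\<lambda>i. i \<in> K \<and> y i))"
proof -
  have "(\<lambda>y i. i \<in> K \<and> y i) \<in> measurable (PiM K (\<lambda>_. count_space UNIV)) (coins p)"
    unfolding measurable_coins_iff
  proof
    fix i
    show "(\<lambda>y. i \<in> K \<and> y i) \<in> measurable (PiM K (\<lambda>_. count_space UNIV)) (count_space UNIV)"
      using measurable_component_singleton[of i K "\<lambda>_. count_space UNIV"] by (cases "i \<in> K") auto
  qed
  from measurable_compose[OF this assms] show ?thesis .
qed

text \<open>Blocks of independent coins over disjoint index sets are independent, and each event is
  a function of its own block.\<close>

lemma prob_coins_disjoint_supports:
  assumes "finite J" "J \<noteq> {}" "disjoint_family_on K J"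
    and meas: "\<And>j. j \<in> J \<Longrightarrow> Measurable.pred (coins p) (\<Phi> j)"
    and dep: "\<And>j. j \<in> J \<Longrightarrow> depends_on (\<Phi> j) (K j)"
  shows "measure (coins p) {x. \<forall>j\<in>J. \<Phi> j x} = (\<Prod>j\<in>J. measure (coins p) {x. \<Phi> j x})"
proof -
  interpret prob_space "coins p" by (rule prob_space_coins)
  have "indep_vars (\<lambda>j. PiM (K j) (\<lambda>_. count_space UNIV)) (\<lambda>j x. restrict (\<lambda>i. x i) (K j)) J"
    by (rule indep_vars_restrict[OF indep_vars_coins _ assms(3)]) auto
  then have "indep_vars (\<lambda>_. count_space UNIV)
      (\<lambda>j x. \<Phi> j (\<lambda>i. i \<in> K j \<and> restrict (\<lambda>i. x i) (K j) i)) J"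
    by (rule indep_vars_compose2[where Y = "\<lambda>j y. \<Phi> j (\<lambda>i. i \<in> K j \<and> y i)"])
      (rule pred_coins_restrict[OF meas])
  from indep_varsD_finite[OF this assms(2,1), of "\<lambda>_. {True}"]
  have "measure (coins p) (\<Inter>j\<in>J. {x. \<Phi> j (\<lambda>i. i \<in> K j \<and> restrict (\<lambda>i. x i) (K j) i)}) =
      (\<Prod>j\<in>J. measure (coins p) {x. \<Phi> j (\<lambda>i. i \<in> K j \<and> restrict (\<lambda>i. x i) (K j) i)})"
    by (simp add: vimage_def)
  moreover have "\<Phi> j (\<lambda>i. i \<in> K j \<and> restrict (\<lambda>i. x i) (K j) i) = \<Phi> j x" if "j \<in> J" for j x
    by (rule depends_onD[OF dep[OF that]]) auto
  ultimately have "measure (coins p) (\<Inter>j\<in>J. {x. \<Phi> j x}) = (\<Prod>j\<in>J. measure (coins p) {x. \<Phi> j x})"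
    by (simp cong: INF_cong prod.cong)
  moreover have "(\<Inter>j\<in>J. {x. \<Phi> j x}) = {x. \<forall>j\<in>J. \<Phi> j x}" by auto
  ultimately show ?thesis by simp
qed

lemma prob_coins_indep:
  assumes "K \<inter> K' = {}"
    and "Measurable.pred (coins p) \<Phi>" "depends_on \<Phi> K"
    and "Measurable.pred (coins p) \<Psi>" "depends_on \<Psi> K'"
  shows "measure (coins p) {x. \<Phi> x \<and> \<Psi> x} = measure (coins p) {x. \<Phi> x} * measure (coins p) {x. \<Psi> x}"
proof -
  have "measure (coins p) {x. \<forall>j\<in>UNIV. case_bool \<Phi> \<Psi> j x} =
      (\<Prod>j\<in>UNIV. measure (coins p) {x. case_bool \<Phi> \<Psi> j x})"
  proof (rule prob_coins_disjoint_supports[of UNIV "case_bool K K'"])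
    show "disjoint_family_on (case_bool K K') UNIV"
      using assms(1) by (auto simp: disjoint_family_on_def split: bool.split_asm)
    fix j
    show "Measurable.pred (coins p) (case_bool \<Phi> \<Psi> j)"
      by (cases j) (simp_all add: assms(2,4))
    show "depends_on (case_bool \<Phi> \<Psi> j) (case_bool K K' j)"
      by (cases j) (simp_all add: assms(3,5))
  qed auto
  moreover have "{x. \<forall>j\<in>UNIV. case_bool \<Phi> \<Psi> j x} = {x. \<Phi> x \<and> \<Psi> x}"
    by (auto simp: UNIV_bool)
  ultimately show ?thesis by (simp add: UNIV_bool mult.commute)
qed

lemma prob_coins_all:
  assumes "finite F" "0 \<le> p" "p \<le> 1"
  shows "measure (coins p) {x. \<forall>i\<in>F. x i} = p ^ card F"
proof (cases "F = {}")
  case True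
  then show ?thesis using prob_space.prob_space[OF prob_space_coins] by simp
next
  case False
  have "measure (coins p) {x. \<forall>i\<in>F. x i} = (\<Prod>i\<in>F. measure (coins p) {x. x i})"
    using assms False
    by (intro prob_coins_disjoint_supports[of F "\<lambda>i. {i}"])
      (auto simp: disjoint_family_on_def depends_on_def)
  then show ?thesis using assms by (simp add: prob_coins_component)
qed

text \<open>An elementary form of conditioning on the finitely many coins in F: if \<Psi> has
  probability at most \<epsilon> once F is frozen to any pattern satisfying \<Phi>, then summing
  over these patterns gives the bound.\<close>

lemma prob_coins_override:
  assumes F: "finite F" and \<Phi>: "depends_on \<Phi> F" and \<Psi>: "Measurable.pred (coins p) \<Psi>"
    and le: "\<And>x. \<Phi> x \<Longrightarrow> measure (coins p) {y. \<Psi> (override_on y x F)} \<le> \<epsilon>"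
  shows "measure (coins p) {x. \<Phi> x \<and> \<Psi> x} \<le> \<epsilon> * measure (coins p) {x. \<Phi> x}"
proof -
  interpret prob_space "coins p" by (rule prob_space_coins)
  \<comment> \<open>A cell fixes the pattern S on F; the cells with S in \<open>G\<close> partition
    the event \<Phi>.\<close>
  define c where "c S x \<longleftrightarrow> (\<forall>i\<in>F. x i = (i \<in> S))" for S x
  define G where "G = {S \<in> Pow F. \<Phi> (\<lambda>i. i \<in> S)}"
  have finG: "finite G" using F by (simp add: G_def)
  have c_dep: "depends_on (c S) F" for S by (rule depends_onI) (simp add: c_def)
  have c_pred: "Measurable.pred (coins p) (c S)" for S
    by (rule pred_finite_support[OF F c_dep])
  have \<Phi>_iff: "\<Phi> x \<longleftrightarrow> (\<exists>S\<in>G. c S x)" for x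
  proof
    assume "\<Phi> x"
    moreover have "\<Phi> x = \<Phi> (\<lambda>i. i \<in> {i \<in> F. x i})"
      by (rule depends_onD[OF \<Phi>]) auto
    ultimately show "\<exists>S\<in>G. c S x"
      by (intro bexI[of _ "{i \<in> F. x i}"]) (auto simp: G_def c_def)
  next
    assume "\<exists>S\<in>G. c S x"
    then obtain S where "\<Phi> (\<lambda>i. i \<in> S)" "c S x" by (auto simp: G_def)
    with depends_onD[OF \<Phi>, of x "\<lambda>i. i \<in> S"] show "\<Phi> x" by (auto simp: c_def)
  qed
  have disj: "disjoint_family_on (\<lambda>S. {x. c S x \<and> R x}) G" for R
  proof -
    have "S = S'" if "S \<in> G" "S' \<in> G" "c S x" "c S' x" for S S' x
      using that unfolding G_def c_def by blast
    then show ?thesis by (auto simp: disjoint_family_on_def)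
  qed
  have split: "measure (coins p) {x. \<Phi> x \<and> R x} = (\<Sum>S\<in>G. measure (coins p) {x. c S x \<and> R x})"
    if "Measurable.pred (coins p) R" for R
  proof -
    have "{x. \<Phi> x \<and> R x} = (\<Union>S\<in>G. {x. c S x \<and> R x})" by (auto simp: \<Phi>_iff)
    moreover have "{x. c S x \<and> R x} \<in> sets (coins p)" for S
    proof -
      have "Measurable.pred (coins p) (\<lambda>x. c S x \<and> R x)" 
        by (intro pred_intros_logic c_pred that)
      then show ?thesis by (simp add: pred_def)
    qed
    ultimately show ?thesis
      using finG disj by (auto intro!: finite_measure_finite_Union)
  qed
  have cell: "measure (coins p) {x. c S x \<and> \<Psi> x} \<le> \<epsilon> * measure (coins p) {x. c S x}" if "S \<in> G" for S
  proof -
    \<comment> \<open>With F frozen to S, the event depends only on the coins outside F and is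
      independent of the cell.\<close>
    let ?\<Psi> = "\<lambda>y. \<Psi> (override_on y (\<lambda>i. i \<in> S) F)"
    have "override_on x (\<lambda>i. i \<in> S) F = x" if "c S x" for x
      using that by (auto simp: c_def override_on_def)
    then have "{x. c S x \<and> \<Psi> x} = {x. c S x \<and> ?\<Psi> x}" by auto
    also have "measure (coins p) \<dots> = measure (coins p) {x. c S x} * measure (coins p) {y. ?\<Psi> y}"
    proof (rule prob_coins_indep[of F "- F"])
      show "depends_on ?\<Psi> (- F)"
      proof (rule depends_onI)
        fix x y :: "'a \<Rightarrow> bool" assume "\<And>i. i \<in> - F \<Longrightarrow> x i = y i"
        then have "override_on x (\<lambda>i. i \<in> S) F = override_on y (\<lambda>i. i \<in> S) F"
          by (auto simp: override_on_def)
        then show "?\<Psi> x = ?\<Psi> y" by simp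
      qed
      show "Measurable.pred (coins p) ?\<Psi>"
        by (rule measurable_compose[OF measurable_coins_override \<Psi>])
    qed (fact c_pred c_dep Compl_disjoint)+
    also have "\<dots> \<le> measure (coins p) {x. c S x} * \<epsilon>"
      using le that by (intro mult_left_mono) (auto simp: G_def)
    finally show ?thesis by (simp add: mult.commute)
  qed
  have "measure (coins p) {x. \<Phi> x \<and> \<Psi> x} \<le> (\<Sum>S\<in>G. \<epsilon> * measure (coins p) {x. c S x})"
    unfolding split[OF \<Psi>] by (intro sum_mono cell)
  also have "\<dots> = \<epsilon> * measure (coins p) {x. \<Phi> x}"
    using split[of "\<lambda>_. True"] by (simp add: sum_distrib_left)
  finally show ?thesis .
qed

text \<open>Hoeffding's inequality for the lower tail: the summands have range [0, 1], so a
  deviation of \<epsilon> card C below the mean p card C has probability at most exp(-2 (\<epsilon>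
  card C)^2 / card C).\<close>

lemma prob_coins_few:
  assumes C: "finite C" and p: "0 \<le> p" "p \<le> 1" and "0 \<le> \<epsilon>"
  shows "measure (coins p) {x. real (card {i \<in> C. x i}) \<le> (p - \<epsilon>) * real (card C)} \<le>
    exp (- 2 * \<epsilon>\<^sup>2 * real (card C))"
proof (cases "C = {}")
  case True
  interpret prob_space "coins p" by (rule prob_space_coins)
  show ?thesis using True by simp
next
  case False
  interpret prob_space "coins p" by (rule prob_space_coins)
  let ?X = "\<lambda>i x. of_bool (x i) :: real"
  interpret H: Hoeffding_ineq "coins p" C ?X "\<lambda>_. 0" "\<lambda>_. 1" "\<Sum>i\<in>C. expectation (?X i)"
  proof unfold_locales
    show "indep_vars (\<lambda>_. borel) ?X C"
      by (rule indep_vars_compose2[OF indep_vars_subset[OF indep_vars_coins]]) auto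
  qed (use C in auto)
  have E: "expectation (?X i) = p" for i
  proof -
    have "expectation (?X i) = expectation (indicator {x. x i})"
      by (intro Bochner_Integration.integral_cong) (auto simp: indicator_def)
    also have "\<dots> = measure (coins p) {x. x i}"
      by simp
    finally show ?thesis using p by (simp add: prob_coins_component)
  qed
  have sum: "(\<Sum>i\<in>C. ?X i x) = real (card {i \<in> C. x i})" for x
    using C by (simp add: of_bool_def sum.If_cases Int_def)
  have n: "real (card C) > 0" using C False by (simp add: card_gt_0_iff)
  have "measure (coins p) {x. real (card {i \<in> C. x i}) \<le> real (card C) * p - \<epsilon> * real (card C)}
      \<le> exp (- 2 * (\<epsilon> * real (card C))\<^sup>2 / real (card C))"
    using H.Hoeffding_ineq_le[of "\<epsilon> * real (card C)"] n assms(4) by (simp add: E sum)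
  also have "- 2 * (\<epsilon> * real (card C))\<^sup>2 / real (card C) = - 2 * \<epsilon>\<^sup>2 * real (card C)"
    using n by (simp add: power2_eq_square)
  finally show ?thesis by (simp add: algebra_simps)
qed

text \<open>The labels over I and the coordinates of the coin space over I have the same joint law,
  a product of Bernoulli measures. So an almost sure event that depends on I alone passes from one
  space to the other.\<close>

lemma AE_coins_transfer:
  assumes P: "prob_space P" and I: "I \<noteq> {}"
    and ind: "prob_space.indep_vars P (\<lambda>_. count_space UNIV) Y I"
    and distr: "\<And>i. i \<in> I \<Longrightarrow> distr P (count_space UNIV) (Y i) = measure_pmf (bernoulli_pmf p)"
    and meas: "Measurable.pred (coins p) \<Phi>" and dep: "depends_on \<Phi> I"
    and AE: "AE x in coins p. \<Phi> x"
  shows "AE \<omega> in P. \<Phi> (\<lambda>i. Y i \<omega>)"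
proof -
  interpret prob_space P by fact
  let ?N = "PiM I (\<lambda>_. count_space (UNIV :: bool set))"
  let ?B = "PiM I (\<lambda>_. measure_pmf (bernoulli_pmf p))"
  let ?\<Phi> = "\<lambda>y. \<Phi> (\<lambda>i. i \<in> I \<and> y i)"
  have pred: "Measurable.pred ?N ?\<Phi>" by (rule pred_coins_restrict[OF meas])
  have \<Phi>: "?\<Phi> (restrict x I) = \<Phi> x" for x
    by (rule depends_onD[OF dep]) auto
  have Y: "Y i \<in> measurable P (count_space UNIV)" if "i \<in> I" for i
    using ind that unfolding indep_vars_def by blast
  have "distr P ?N (\<lambda>\<omega>. \<lambda>i\<in>I. Y i \<omega>) = PiM I (\<lambda>i. distr P (count_space UNIV) (Y i))"
    using indep_vars_iff_distr_eq_PiM'[OF I Y] ind by simp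
  also have "\<dots> = ?B"
    by (intro PiM_cong) (auto simp: distr)
  finally have 1: "distr P ?N (\<lambda>\<omega>. \<lambda>i\<in>I. Y i \<omega>) = ?B" .
  have "distr (coins p) ?N (\<lambda>x. restrict x I) = distr (coins p) ?B (\<lambda>x. restrict x I)"
    by (intro distr_cong refl sets_PiM_cong) auto
  also have "\<dots> = ?B"
    unfolding coins_def
    using distr_PiM_reindex[of UNIV "\<lambda>_. measure_pmf (bernoulli_pmf p)" "\<lambda>i. i" I]
    by (simp add: prob_space_measure_pmf)
  finally have 2: "distr (coins p) ?N (\<lambda>x. restrict x I) = ?B" .
  have pred': "{y \<in> space ?N. ?\<Phi> y} \<in> sets ?N" using pred unfolding pred_def .
  have "(\<lambda>x. restrict x I) \<in> measurable (coins p) ?N"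
    by (intro measurable_restrict measurable_coins_component)
  from AE_distr_iff[OF this pred'] AE have "AE y in ?B. ?\<Phi> y"
    by (simp only: 2 \<Phi>)
  moreover have "(\<lambda>\<omega>. \<lambda>i\<in>I. Y i \<omega>) \<in> measurable P ?N"
    by (intro measurable_restrict Y)
  from AE_distr_iff[OF this pred'] have "(AE y in ?B. ?\<Phi> y) \<longleftrightarrow> (AE \<omega> in P. \<Phi> (\<lambda>i. Y i \<omega>))"
    by (simp only: 1 \<Phi>)
  ultimately show ?thesis by simp
qed

section \<open>Branching\<close>

text \<open>Convexity in the form of difference quotients: y^M - e^M = (y - e) s(y), where s is
  strictly smaller at q than at 1, while e < q would give p s(1) = 1 <= p s(q).\<close>

lemma generating_function_fixed_point:
  fixes e q p :: real
  assumes "0 \<le> e" "e \<le> q" "q < 1" "2 \<le> M" "0 < p"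
    and e: "e = 1 - p + p * e ^ M" and q: "q \<le> 1 - p + p * q ^ M"
  shows "q = e"
proof (rule ccontr)
  assume "q \<noteq> e"
  then have eq: "e < q" using assms by simp
  define s where "s y = (\<Sum>k<M. e ^ (M - Suc k) * y ^ k)" for y
  have s: "y ^ M - e ^ M = (y - e) * s y" for y
    unfolding s_def by (rule power_diff_sumr2)
  \<comment> \<open>The number 1 solves the same fixed point equation as e.\<close>
  have "1 - e = p * (1 ^ M - e ^ M)" using e by (simp add: algebra_simps)
  also have "\<dots> = p * s 1 * (1 - e)" unfolding s by simp
  finally have 1: "p * s 1 = 1" using eq assms by simp
  have "q - e \<le> p * (q ^ M - e ^ M)" using e q by (simp add: algebra_simps)
  also have "\<dots> = p * s q * (q - e)" unfolding s by simp
  finally have "1 * (q - e) \<le> p * s q * (q - e)" by simp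
  then have 2: "1 \<le> p * s q" using eq by (subst (asm) mult_le_cancel_right) auto
  have "s q < s 1"
    unfolding s_def
  proof (rule sum_strict_mono_ex1)
    show "\<forall>k\<in>{..<M}. e ^ (M - Suc k) * q ^ k \<le> e ^ (M - Suc k) * 1 ^ k"
      using assms by (auto intro!: mult_left_le power_le_one)
    \<comment> \<open>The top term k = M - 1 has coefficient e^0 = 1, so it is strict even for e =
      0; M >= 2 makes its exponent positive.\<close>
    have "q ^ (M - 1) < 1 ^ (M - 1)" using assms by (intro power_strict_mono) auto
    then show "\<exists>k\<in>{..<M}. e ^ (M - Suc k) * q ^ k < e ^ (M - Suc k) * 1 ^ k"
      using assms by (intro bexI[of _ "M - 1"]) auto
  qed simp
  then have "p * s q < p * s 1" using assms by simp
  with 1 2 show False by simp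
qed

section \<open>Survival of the labelled tree\<close>

definition alive_at :: "nat \<Rightarrow> nat \<Rightarrow> (nat list \<Rightarrow> bool) \<Rightarrow> bool" where
  "alive_at M n x \<longleftrightarrow> (\<exists>w\<in>words M. length w = n \<and> alive x w)"

definition immortal :: "nat \<Rightarrow> (nat list \<Rightarrow> bool) \<Rightarrow> bool" where
  "immortal M x \<longleftrightarrow> (\<forall>n. alive_at M n x)"

lemma alive_at_antimono: "alive_at M n x \<Longrightarrow> k \<le> n \<Longrightarrow> alive_at M k x"
  unfolding alive_at_def by (metis alive_take length_take min.absorb2 take_words)

lemma alive_at_0 [simp]: "alive_at M 0 x \<longleftrightarrow> x []"
  by (auto simp: alive_at_def)

lemma alive_at_Suc: "alive_at M (Suc n) x \<longleftrightarrow> x [] \<and> (\<exists>i<M. alive_at M n (\<lambda>v. x (i # v)))"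
proof
  assume "alive_at M (Suc n) x"
  then show "x [] \<and> (\<exists>i<M. alive_at M n (\<lambda>v. x (i # v)))"
    by (fastforce simp: alive_at_def length_Suc_conv alive_Cons)
next
  assume "x [] \<and> (\<exists>i<M. alive_at M n (\<lambda>v. x (i # v)))"
  then obtain i w where "x []" "i < M" "w \<in> words M" "length w = n" "alive (\<lambda>v. x (i # v)) w"
    by (auto simp: alive_at_def)
  then show "alive_at M (Suc n) x"
    unfolding alive_at_def by (intro bexI[of _ "i # w"]) (auto simp: alive_Cons)
qed

text \<open>Koenig's argument for finite branching: if all children died, they would all be dead by
  a common level.\<close>

lemma immortal_iff: "immortal M x \<longleftrightarrow> x [] \<and> (\<exists>i<M. immortal M (\<lambda>v. x (i # v)))"
proof
  assume im: "immortal M x"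
  show "x [] \<and> (\<exists>i<M. immortal M (\<lambda>v. x (i # v)))"
  proof (rule ccontr)
    assume "\<not> ?thesis"
    moreover have "x []" using im alive_at_0[of M x] unfolding immortal_def by blast
    ultimately have "\<forall>i<M. \<exists>n. \<not> alive_at M n (\<lambda>v. x (i # v))"
      by (auto simp: immortal_def)
    then obtain n where n: "\<And>i. i < M \<Longrightarrow> \<not> alive_at M (n i) (\<lambda>v. x (i # v))"
      by metis
    \<comment> \<open>The sum bounds the extinction levels of all M children at once.\<close>
    have "alive_at M (Suc (\<Sum>i<M. n i)) x" using im by (simp add: immortal_def)
    then obtain i where i: "i < M" "alive_at M (\<Sum>i<M. n i) (\<lambda>v. x (i # v))"
      by (auto simp: alive_at_Suc)
    have "n i \<le> (\<Sum>i<M. n i)" using i by (intro member_le_sum) auto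
    with i n show False using alive_at_antimono by blast
  qed
next
  assume *: "x [] \<and> (\<exists>i<M. immortal M (\<lambda>v. x (i # v)))"
  show "immortal M x"
    unfolding immortal_def
  proof
    fix n
    show "alive_at M n x"
      using * by (cases n) (auto simp: alive_at_Suc immortal_def)
  qed
qed

lemma depends_on_alive_at: "depends_on (alive_at M n) {w \<in> words M. length w \<le> n}"
proof (rule depends_onI)
  fix x y :: "nat list \<Rightarrow> bool" assume *: "\<And>w. w \<in> {w \<in> words M. length w \<le> n} \<Longrightarrow> x w = y w"
  have "alive x w = alive y w" if "w \<in> words M" "length w = n" for w
    using that by (intro alive_cong *) (auto simp: take_words)
  then show "alive_at M n x = alive_at M n y" by (auto simp: alive_at_def)
qed

lemma pred_alive: "Measurable.pred (coins p) (\<lambda>x. alive x w)"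
proof (rule pred_finite_support)
  show "depends_on (\<lambda>x. alive x w) ((\<lambda>k. take k w) ` {..length w})"
    by (rule depends_onI) (auto intro!: alive_cong)
qed auto

lemma pred_immortal: "Measurable.pred (coins p) (immortal M)"
  unfolding immortal_def[abs_def]
  by (intro pred_intros_countable pred_finite_support[OF finite_words_length_le depends_on_alive_at])

text \<open>The root coin and the M subtrees use disjoint sets of coins, and each subtree has the
  law of the whole tree. The event splits into root off, and root on with all subtrees in
  \<Psi>.\<close>

lemma prob_branching:
  assumes p: "0 \<le> p" "p \<le> 1" and "M \<ge> 1" and \<Psi>: "Measurable.pred (coins p) \<Psi>"
  shows "measure (coins p) {x. x [] \<longrightarrow> (\<forall>i<M. \<Psi> (\<lambda>v. x (i # v)))} =
    1 - p + p * measure (coins p) {x. \<Psi> x} ^ M"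
proof -
  interpret prob_space "coins p :: (nat list \<Rightarrow> bool) measure" by (rule prob_space_coins)
  let ?A = "\<lambda>x. \<forall>i\<in>{..<M}. \<Psi> (\<lambda>v. x (i # v))"
  have pred: "Measurable.pred (coins p) (\<lambda>x. \<Psi> (\<lambda>v. x (i # v)))" for i
    by (rule measurable_compose[OF measurable_coins_reindex \<Psi>])
  have dep: "depends_on (\<lambda>x. \<Psi> (\<lambda>v. x (i # v))) (range (Cons i))" for i
  proof (rule depends_onI)
    fix x y :: "nat list \<Rightarrow> bool" assume "\<And>w. w \<in> range (Cons i) \<Longrightarrow> x w = y w"
    then have "(\<lambda>v. x (i # v)) = (\<lambda>v. y (i # v))" by auto
    then show "\<Psi> (\<lambda>v. x (i # v)) = \<Psi> (\<lambda>v. y (i # v))" by simp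
  qed
  have predA: "Measurable.pred (coins p) ?A"
    by (intro pred_intros_finite pred) auto
  have "prob {x. ?A x} = (\<Prod>i\<in>{..<M}. prob {x. \<Psi> (\<lambda>v. x (i # v))})"
    using assms(3)
    by (intro prob_coins_disjoint_supports[of _ "\<lambda>i. range (Cons i)"] pred dep)
      (auto simp: disjoint_family_on_def lessThan_empty_iff)
  also have "\<dots> = (\<Prod>i\<in>{..<M}. prob {x. \<Psi> x})"
    by (intro prod.cong refl prob_coins_reindex[OF _ \<Psi>]) simp
  also have "\<dots> = prob {x. \<Psi> x} ^ M"
    by simp
  finally have A: "prob {x. ?A x} = prob {x. \<Psi> x} ^ M" .
  have and_A: "prob {x. x [] \<and> ?A x} = prob {x. x []} * prob {x. ?A x}"
  proof (rule prob_coins_indep[of "{[]}" "- {[]}"])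
    show "depends_on ?A (- {[]})"
    proof (rule depends_onI)
      fix x y :: "nat list \<Rightarrow> bool" assume "\<And>w. w \<in> - {[]} \<Longrightarrow> x w = y w"
      then show "?A x = ?A y" by simp
    qed
    show "depends_on (\<lambda>x. x []) {[]}" by (rule depends_onI) simp
  qed (fact predA measurable_coins_component Compl_disjoint)+
  have sets: "{x. R x} \<in> events" if "Measurable.pred (coins p) R" for R
    using that unfolding pred_def by simp
  have root: "Measurable.pred (coins p) (\<lambda>x. x [])"
    by (rule measurable_coins_component)
  have "prob {x. x [] \<longrightarrow> (\<forall>i<M. \<Psi> (\<lambda>v. x (i # v)))} = prob ((UNIV - {x. x []}) \<union> {x. x [] \<and> ?A x})"
    by (intro arg_cong[of _ _ prob]) auto
  also have "\<dots> = prob (UNIV - {x. x []}) + prob {x. x [] \<and> ?A x}"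
    using sets[OF root] sets.compl_sets[OF sets[OF root]] sets[OF pred_intros_logic(3)[OF root predA]]
    by (intro finite_measure_Union) auto
  also have "prob (UNIV - {x. x []}) = 1 - p"
    using prob_compl[OF sets[OF root]] p by (simp add: prob_coins_component)
  finally show ?thesis using p by (simp add: and_A A prob_coins_component)
qed

text \<open>Upgrades positive probability of a good event to an almost sure good descendant, by
  comparing the probabilities of failure and of extinction.\<close>

lemma AE_immortal_imp_descendant:
  assumes p: "0 < p" "p < 1" and M: "M \<ge> 2"
    and \<Phi>: "Measurable.pred (coins p) \<Phi>" and im: "\<And>x. \<Phi> x \<Longrightarrow> immortal M x"
    and pos: "measure (coins p) {x. \<Phi> x} > 0"
  shows "AE x in coins p. immortal M x \<longrightarrow> (\<exists>w\<in>words M. alive x w \<and> \<Phi> (\<lambda>v. x (w @ v)))"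
proof -
  interpret prob_space "coins p :: (nat list \<Rightarrow> bool) measure" by (rule prob_space_coins)
  \<comment> \<open>Including immortality makes extinction a case of failure, so e <= q, and makes
    \<open>H\<close> a subevent of survival, so equal probabilities leave a null difference.\<close>
  define H where "H x \<longleftrightarrow> immortal M x \<and> (\<exists>w. w \<in> words M \<and> alive x w \<and> \<Phi> (\<lambda>v. x (w @ v)))" for x
  have pred_H: "Measurable.pred (coins p) H"
    unfolding H_def[abs_def]
    by (intro pred_intros_logic pred_intros_countable pred_immortal pred_alive
        measurable_compose[OF measurable_coins_reindex \<Phi>]) simp
  have sets: "{x. R x} \<in> events" if "Measurable.pred (coins p) R" for R
    using that unfolding pred_def by simp
  have compl: "prob {x. \<not> R x} = 1 - prob {x. R x}" if "Measurable.pred (coins p) R" for R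
    using prob_compl[OF sets[OF that]] by (simp add: set_diff_eq)
  have step: "H x" if x: "x []" "i < M" "H (\<lambda>v. x (i # v))" for x i
  proof -
    obtain w where "w \<in> words M" "alive (\<lambda>v. x (i # v)) w" "\<Phi> (\<lambda>v. x (i # w @ v))"
      using x by (auto simp: H_def)
    then have "\<exists>w. w \<in> words M \<and> alive x w \<and> \<Phi> (\<lambda>v. x (w @ v))"
      using that by (intro exI[of _ "i # w"]) (auto simp: alive_Cons)
    moreover have "immortal M x" using that by (subst immortal_iff) (auto simp: H_def)
    ultimately show ?thesis by (simp add: H_def)
  qed
  have not_H: "Measurable.pred (coins p) (\<lambda>x. \<not> H x)"
    and not_im: "Measurable.pred (coins p) (\<lambda>x. \<not> immortal M x)"
    by (intro pred_intros_logic pred_H pred_immortal)+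
  have "prob {x. \<not> immortal M x} =
      prob {x. x [] \<longrightarrow> (\<forall>i<M. \<not> immortal M (\<lambda>v. x (i # v)))}"
    by (rule arg_cong[of _ _ prob]) (subst immortal_iff, auto)
  also have "\<dots> = 1 - p + p * prob {x. \<not> immortal M x} ^ M"
    using p M by (intro prob_branching not_im) auto
  finally have e: "prob {x. \<not> immortal M x} = 1 - p + p * prob {x. \<not> immortal M x} ^ M" .
  have pred: "Measurable.pred (coins p) (\<lambda>x. x [] \<longrightarrow> (\<forall>i<M. \<not> H (\<lambda>v. x (i # v))))"
    by (intro pred_intros_logic pred_intros_countable measurable_coins_component
        measurable_compose[OF measurable_coins_reindex pred_H]) simp
  \<comment> \<open>Failure at a root that is on passes to every child. The converse can break down
    when \<Phi> holds at the root itself, hence the inequality.\<close>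
  have "prob {x. \<not> H x} \<le> prob {x. x [] \<longrightarrow> (\<forall>i<M. \<not> H (\<lambda>v. x (i # v)))}"
    using step by (intro finite_measure_mono sets[OF pred]) auto
  also have "\<dots> = 1 - p + p * prob {x. \<not> H x} ^ M"
    using p M by (intro prob_branching not_H) auto
  finally have q: "prob {x. \<not> H x} \<le> 1 - p + p * prob {x. \<not> H x} ^ M" .
  \<comment> \<open>The empty word serves as descendant; together with the positive probability of
    \<Phi> this gives q < 1.\<close>
  have "H x" if "\<Phi> x" for x
  proof -
    have "immortal M x" using im that by blast
    moreover from this have "x []" using immortal_iff by blast
    ultimately show ?thesis using that unfolding H_def by (intro conjI exI[of _ "[]"]) auto
  qed
  then have "prob {x. \<Phi> x} \<le> prob {x. H x}"
    by (intro finite_measure_mono sets[OF pred_H]) auto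
  then have lt: "prob {x. \<not> H x} < 1" using pos compl[OF pred_H] by simp
  have le: "prob {x. \<not> immortal M x} \<le> prob {x. \<not> H x}"
    by (intro finite_measure_mono sets[OF not_H]) (auto simp: H_def)
  have "prob {x. \<not> H x} = prob {x. \<not> immortal M x}"
    by (rule generating_function_fixed_point[OF measure_nonneg le lt M p(1) e q])
  then have eq: "prob {x. H x} = prob {x. immortal M x}"
    using compl[OF pred_H] compl[OF pred_immortal] by simp
  have "prob ({x. immortal M x} - {x. H x}) = 0"
  proof -
    have "{x. H x} \<subseteq> {x. immortal M x}" by (auto simp: H_def)
    from finite_measure_Diff[OF sets[OF pred_immortal] sets[OF pred_H] this] eq show ?thesis
      by simp
  qed
  then have "AE x in coins p. x \<notin> {x. immortal M x} - {x. H x}"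
    using sets[OF pred_H] sets[OF pred_immortal]
    by (intro AE_not_in) (auto simp: null_sets_def emeasure_eq_measure)
  then show ?thesis
    by eventually_elim (auto simp: H_def)
qed

section \<open>Growth of the counts\<close>

context typed_ifs
begin

text \<open>These are the alive words that map \<open>J v\<close> onto the cylinder of
  \<open>J u0\<close> at b followed by a.\<close>

definition tracked :: "nat list \<Rightarrow> nat list \<Rightarrow> int \<Rightarrow> (nat list \<Rightarrow> bool) \<Rightarrow> nat list set" where
  "tracked b a v x = {w \<in> words M. length w = length b + length a \<and> alive x w \<and>
     track L t u0 (b @ a) w = v}"

definition plenty :: "real \<Rightarrow> real \<Rightarrow> nat list \<Rightarrow> nat \<Rightarrow> (nat list \<Rightarrow> bool) \<Rightarrow> bool" where
  "plenty m r b n x \<longleftrightarrow> (\<forall>a\<in>words L. length a = n \<longrightarrow>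
     (\<forall>v\<in>T. m * r ^ n \<le> real (card (tracked b a v x))))"

text \<open>Requiring all coins up to the length of b makes the initial event one of finitely many
  coins, with deterministic initial counts.\<close>

definition plenty_upto :: "real \<Rightarrow> real \<Rightarrow> nat list \<Rightarrow> nat \<Rightarrow> (nat list \<Rightarrow> bool) \<Rightarrow> bool" where
  "plenty_upto m r b n x \<longleftrightarrow> (\<forall>w\<in>words M. length w \<le> length b \<longrightarrow> x w) \<and>
     (\<forall>k\<le>n. plenty m r b k x)"

lemma finite_tracked: "finite (tracked b a v x)"
  unfolding tracked_def by (rule finite_subset[OF _ finite_words_length]) auto

lemma tracked_cong:
  assumes "\<And>w. w \<in> words M \<Longrightarrow> length w \<le> length b + length a \<Longrightarrow> x w = y w"
  shows "tracked b a v x = tracked b a v y"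
proof -
  have "alive x w = alive y w" if "w \<in> words M" "length w = length b + length a" for w
    using that by (intro alive_cong assms) (auto simp: take_words)
  then show ?thesis by (auto simp: tracked_def)
qed

lemma plenty_cong:
  assumes "\<And>w. w \<in> words M \<Longrightarrow> length w \<le> length b + n \<Longrightarrow> x w = y w"
  shows "plenty m r b n x = plenty m r b n y"
proof -
  have "tracked b a v x = tracked b a v y" if "length a = n" for a v
    using that by (intro tracked_cong assms) auto
  then show ?thesis by (auto simp: plenty_def)
qed

lemma depends_on_plenty: "depends_on (plenty m r b n) {w \<in> words M. length w \<le> length b + n}"
  by (rule depends_onI) (auto intro!: plenty_cong)

lemma depends_on_plenty_upto: "depends_on (plenty_upto m r b n) {w \<in> words M. length w \<le> length b + n}"
proof (rule depends_onI)
  fix x y :: "nat list \<Rightarrow> bool"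
  assume *: "\<And>w. w \<in> {w \<in> words M. length w \<le> length b + n} \<Longrightarrow> x w = y w"
  have "plenty m r b k x = plenty m r b k y" if "k \<le> n" for k
    using that by (intro plenty_cong *) auto
  then show "plenty_upto m r b n x = plenty_upto m r b n y"
    using * by (auto simp: plenty_upto_def)
qed

text \<open>Here x carries the labels up to the current level and y the fresh ones: the prefix
  survives by x, and only the coin of the extended word is read from y.\<close>

lemma tracked_extensions:
  assumes "a \<in> words L"
  shows "{s \<in> extensions {s \<in> words M. length s = length b + length a \<and> alive x s} (b @ a) a' v.
      y s} \<subseteq>
    tracked b (a @ [a']) v (override_on y x {w \<in> words M. length w \<le> length b + length a})"
    (is "?E \<subseteq> tracked _ _ _ ?z")
proof
  fix s' assume "s' \<in> ?E"
  then obtain s i where s: "s \<in> words M" "length s = length b + length a" "alive x s" "i < M"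
      "s' = s @ [i]" "track L t u0 ((b @ a) @ [a']) s' = v" "y s'"
    by (auto dest!: extensionsD)
  have "alive ?z s = alive x s"
    using s by (intro alive_cong) (auto simp: override_on_def take_words)
  then have "alive ?z s'" using s by (auto simp: alive_snoc override_on_def)
  then show "s' \<in> tracked b (a @ [a']) v ?z"
    using s by (auto simp: tracked_def)
qed

text \<open>Freezing the labels up to the current level makes the candidates for the next level
  deterministic. Hoeffding's inequality for their fresh coins bounds each failure, and there are
  L^(n+1) card T pairs of a cylinder and a type.\<close>

lemma prob_plenty_step:
  assumes m: "0 < m" and r: "1 < r" and \<epsilon>: "0 < \<epsilon>"
    and r_le: "\<And>a v. a < L \<Longrightarrow> v \<in> T \<Longrightarrow> r \<le> (p - \<epsilon>) * real (card (parents a v))"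
  shows "measure (coins p) {x. plenty_upto m r b n x \<and> \<not> plenty m r b (Suc n) x} \<le>
    (real L ^ Suc n * real (card T) * exp (- 2 * \<epsilon>\<^sup>2 * (m * r ^ n))) *
    measure (coins p) {x. plenty_upto m r b n x}"
proof (rule prob_coins_override)
  let ?F = "{w \<in> words M. length w \<le> length b + n}"
  show "finite ?F" by (rule finite_words_length_le)
  show "depends_on (plenty_upto m r b n) ?F" by (rule depends_on_plenty_upto)
  show "Measurable.pred (coins p) (\<lambda>x. \<not> plenty m r b (Suc n) x)"
    by (intro pred_intros_logic pred_finite_support[OF finite_words_length_le depends_on_plenty])
  fix x assume x: "plenty_upto m r b n x"
  interpret prob_space "coins p :: (nat list \<Rightarrow> bool) measure" by (rule prob_space_coins)
  define S where "S = {s \<in> words M. length s = length b + n \<and> alive x s}"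
  \<comment> \<open>Candidates for level n + 1: one-letter extensions of surviving words, fixed by x
    before the new coins are tossed.\<close>
  define C where "C a v = extensions S (b @ butlast a) (last a) v" for a v
  define J where "J = {a \<in> words L. length a = Suc n} \<times> T"
  define B where "B = (\<lambda>(a, v). {y. real (card {s \<in> C a v. y s}) \<le> (p - \<epsilon>) * real (card (C a v))})"
  have S: "finite S"
    unfolding S_def by (rule finite_subset[OF _ finite_words_length]) auto
  have J: "finite J" "card J = L ^ Suc n * card T"
    unfolding J_def using finite_words_length finite_T
    by (auto simp: card_cartesian_product card_words_length)
  have C: "finite (C a v)" for a v
    unfolding C_def by (rule finite_extensions[OF S])
  have snoc: "\<exists>a0 a'. a = a0 @ [a'] \<and> a0 \<in> words L \<and> length a0 = n \<and> a' < L \<and> v \<in> T"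
    if "(a, v) \<in> J" for a v
    using that by (cases a rule: rev_cases) (auto simp: J_def)
  have large: "m * r ^ n * real (card (parents (last a) v)) \<le> real (card (C a v))"
    if j: "(a, v) \<in> J" for a v
    unfolding C_def
  proof (rule card_extensions[OF S])
    fix u assume u: "u \<in> T"
    obtain a0 a' where a: "a = a0 @ [a']" "a0 \<in> words L" "length a0 = n" using snoc[OF j] by blast
    have eq: "{s \<in> S. track L t u0 (b @ butlast a) s = u} = tracked b a0 u x"
      using a by (auto simp: tracked_def S_def)
    have "plenty m r b n x" using x by (simp add: plenty_upto_def)
    then show "m * r ^ n \<le> real (card {s \<in> S. track L t u0 (b @ butlast a) s = u})"
      unfolding eq plenty_def using u a by blast
  qed
  have mr: "0 < m * r ^ n" using m r by simp
  have parents_ge: "1 \<le> real (card (parents (last a) v))" if j: "(a, v) \<in> J" for a v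
    using snoc[OF j] card_parents_ge_2[of v "last a"] by auto
  \<comment> \<open>There are at least m r^n candidates per parent, and (p - \<epsilon>) times the
    number of parents is at least r. So falling short of m r^(n+1) is a Hoeffding deviation.\<close>
  have thr: "m * r ^ Suc n \<le> (p - \<epsilon>) * real (card (C a v))" if j: "(a, v) \<in> J" for a v
  proof -
    have r': "r \<le> (p - \<epsilon>) * real (card (parents (last a) v))"
      using snoc[OF j] by (auto intro!: r_le)
    then have "0 < (p - \<epsilon>) * real (card (parents (last a) v))" using r by linarith
    then have p\<epsilon>: "0 < p - \<epsilon>" by (simp add: zero_less_mult_iff)
    have "m * r ^ Suc n = (m * r ^ n) * r" by simp
    also have "\<dots> \<le> (m * r ^ n) * ((p - \<epsilon>) * real (card (parents (last a) v)))"
      using r' mr by (intro mult_left_mono) auto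
    also have "\<dots> = (p - \<epsilon>) * (m * r ^ n * real (card (parents (last a) v)))"
      by (simp add: ac_simps)
    also have "\<dots> \<le> (p - \<epsilon>) * real (card (C a v))"
      using large[OF j] p\<epsilon> by (intro mult_left_mono) auto
    finally show ?thesis .
  qed
  have "{y. \<not> plenty m r b (Suc n) (override_on y x ?F)} \<subseteq> (\<Union>j\<in>J. B j)"
  proof
    fix y assume "y \<in> {y. \<not> plenty m r b (Suc n) (override_on y x ?F)}"
    then obtain a v where a: "a \<in> words L" "length a = Suc n" "v \<in> T"
      and less: "real (card (tracked b a v (override_on y x ?F))) < m * r ^ Suc n"
      by (auto simp: plenty_def not_le)
    have j: "(a, v) \<in> J" using a by (simp add: J_def)
    obtain a0 a' where a0: "a = a0 @ [a']" "a0 \<in> words L" "length a0 = n" using snoc[OF j] by blast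
    have "{s \<in> C a v. y s} \<subseteq> tracked b a v (override_on y x ?F)"
      using tracked_extensions[OF a0(2), of b x a' v y] a0 by (simp add: C_def S_def)
    then have "real (card {s \<in> C a v. y s}) \<le> real (card (tracked b a v (override_on y x ?F)))"
      by (simp add: card_mono finite_tracked)
    also have "\<dots> \<le> (p - \<epsilon>) * real (card (C a v))" using less thr[OF j] by linarith
    finally have "y \<in> B (a, v)" by (simp add: B_def)
    with j show "y \<in> (\<Union>j\<in>J. B j)" by blast
  qed
  moreover have B_sets: "B j \<in> events" for j
  proof -
    obtain a v where j: "j = (a, v)" by (cases j)
    have "Measurable.pred (coins p) (\<lambda>y. real (card {s \<in> C a v. y s}) \<le> (p - \<epsilon>) * real (card (C a v)))"
    proof (rule pred_finite_support[OF C[of a v]], rule depends_onI)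
      fix x y :: "nat list \<Rightarrow> bool" assume "\<And>i. i \<in> C a v \<Longrightarrow> x i = y i"
      then have "{s \<in> C a v. x s} = {s \<in> C a v. y s}" by auto
      then show "(real (card {s \<in> C a v. x s}) \<le> (p - \<epsilon>) * real (card (C a v))) =
        (real (card {s \<in> C a v. y s}) \<le> (p - \<epsilon>) * real (card (C a v)))" by simp
    qed
    then show ?thesis by (simp add: pred_def B_def j)
  qed
  ultimately have "prob {y. \<not> plenty m r b (Suc n) (override_on y x ?F)} \<le> prob (\<Union>j\<in>J. B j)"
    using J by (intro finite_measure_mono sets.finite_UN) auto
  also have "\<dots> \<le> (\<Sum>j\<in>J. prob (B j))"
    using B_sets by (intro finite_measure_subadditive_finite J) auto
  also have "\<dots> \<le> (\<Sum>j\<in>J. exp (- 2 * \<epsilon>\<^sup>2 * (m * r ^ n)))"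
  proof (rule sum_mono)
    fix j assume "j \<in> J"
    then obtain a v where j: "j = (a, v)" "(a, v) \<in> J" by (cases j) auto
    \<comment> \<open>A single parent already supplies the m r^n candidates that appear in the
      exponent.\<close>
    have "m * r ^ n * 1 \<le> m * r ^ n * real (card (parents (last a) v))"
      using mr parents_ge[OF j(2)] by (intro mult_left_mono) auto
    then have card: "m * r ^ n \<le> real (card (C a v))" using large[OF j(2)] by linarith
    have "prob (B j) \<le> exp (- 2 * \<epsilon>\<^sup>2 * real (card (C a v)))"
      unfolding B_def j case_prod_conv using p \<epsilon> by (intro prob_coins_few[OF C]) auto
    also have "\<dots> \<le> exp (- 2 * \<epsilon>\<^sup>2 * (m * r ^ n))"
      using card by (auto intro!: mult_left_mono)
    finally show "prob (B j) \<le> exp (- 2 * \<epsilon>\<^sup>2 * (m * r ^ n))" .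
  qed
  also have "\<dots> = real L ^ Suc n * real (card T) * exp (- 2 * \<epsilon>\<^sup>2 * (m * r ^ n))"
    by (simp add: J)
  finally show "prob {y. \<not> plenty m r b (Suc n) (override_on y x ?F)} \<le>
    real L ^ Suc n * real (card T) * exp (- 2 * \<epsilon>\<^sup>2 * (m * r ^ n))" .
qed

text \<open>There are finitely many digits and types, so the minimum \<rho> of p times the number of
  parents still exceeds 1, which leaves room for both r and \<epsilon>.\<close>

lemma growth_rate:
  obtains r \<epsilon> where "1 < r" "0 < \<epsilon>"
    "\<And>a v. a < L \<Longrightarrow> v \<in> T \<Longrightarrow> r \<le> (p - \<epsilon>) * real (card (parents a v))"
proof -
  define \<rho> where "\<rho> = Min ((\<lambda>(a, v). p * real (card (parents a v))) ` ({..<L} \<times> T))"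
  have fin: "finite ((\<lambda>(a, v). p * real (card (parents a v))) ` ({..<L} \<times> T))"
    using finite_T by simp
  have le: "\<rho> \<le> p * real (card (parents a v))" if "a < L" "v \<in> T" for a v
    unfolding \<rho>_def using that by (intro Min_le fin) force
  have "\<rho> \<in> (\<lambda>(a, v). p * real (card (parents a v))) ` ({..<L} \<times> T)"
    unfolding \<rho>_def using u0_in_T L_ge_2 by (intro Min_in fin) (auto simp: lessThan_empty_iff)
  then have \<rho>: "1 < \<rho>" using card_parents by auto
  define r where "r = (1 + \<rho>) / 2"
  have r: "1 < r" "r < \<rho>" using \<rho> by (auto simp: r_def)
  show ?thesis
  \<comment> \<open>This \<epsilon> gives p - \<epsilon> = p r / \<rho>, which lowers the guaranteed
    growth from \<rho> to r.\<close>
  proof (rule that[of r "p * (1 - r / \<rho>)"])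
    show "0 < p * (1 - r / \<rho>)" using r \<rho> p by simp
    fix a v assume "a < L" "v \<in> T"
    have "r = (r / \<rho>) * \<rho>" using \<rho> by simp
    also have "\<dots> \<le> (r / \<rho>) * (p * real (card (parents a v)))"
      using le[OF \<open>a < L\<close> \<open>v \<in> T\<close>] r \<rho> by (intro mult_left_mono) auto
    also have "\<dots> = (p - p * (1 - r / \<rho>)) * real (card (parents a v))"
      by (simp add: algebra_simps)
    finally show "r \<le> (p - p * (1 - r / \<rho>)) * real (card (parents a v))" .
  qed (use r in auto)
qed

text \<open>Bernoulli's inequality turns the doubly exponential bound into a geometric one.\<close>

lemma error_bound:
  assumes r: "1 < r" and c: "0 < (c :: real)"
  shows "\<exists>m::nat. 0 < m \<and> (\<forall>n. real L ^ Suc n * real (card T) * exp (- c * (real m * r ^ n)) \<le> (1/2) ^ (n + 2))"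
proof -
  have lim: "(\<lambda>m::nat. d * exp (- k * real m)) \<longlonglongrightarrow> 0" if "k > 0" for d k :: real
    using that by real_asymp
  have "\<forall>\<^sub>F m in sequentially. real L * exp (- (c * (r - 1)) * real m) < 1 / 2"
    using r c by (intro order_tendstoD(2)[OF lim]) auto
  moreover have "\<forall>\<^sub>F m in sequentially. (real L * real (card T)) * exp (- c * real m) < 1 / 4"
    using c by (intro order_tendstoD(2)[OF lim]) auto
  moreover have "\<forall>\<^sub>F m::nat in sequentially. 0 < m" by (rule eventually_gt_at_top)
  ultimately have "\<forall>\<^sub>F m in sequentially. 0 < m \<and> real L * exp (- (c * (r - 1)) * real m) < 1 / 2 \<and>
      (real L * real (card T)) * exp (- c * real m) < 1 / 4"
    by eventually_elim auto
  \<comment> \<open>After Bernoulli's inequality the bound is L card T exp(-c m) times the n-th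
    power of L exp(-c (r - 1) m); m makes these factors less than 1/4 and 1/2.\<close>
  then obtain m :: nat where m: "0 < m" "real L * exp (- (c * (r - 1)) * real m) < 1 / 2"
      "(real L * real (card T)) * exp (- c * real m) < 1 / 4"
    using eventually_happens[of _ sequentially] by auto
  show ?thesis
  proof (intro exI conjI allI)
    show "0 < m" by fact
    fix n
    have "1 + real n * (r - 1) \<le> r ^ n"
      using Bernoulli_inequality[of "r - 1" n] r by simp
    then have "- c * (real m * r ^ n) \<le> - c * (real m * (1 + real n * (r - 1)))"
      using c by (simp add: mult_left_mono)
    then have "exp (- c * (real m * r ^ n)) \<le> exp (- c * (real m * (1 + real n * (r - 1))))"
      by simp
    also have "- c * (real m * (1 + real n * (r - 1))) = - c * real m + real n * (- (c * (r - 1)) * real m)"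
      by (simp add: algebra_simps)
    also have "exp \<dots> = exp (- c * real m) * exp (- (c * (r - 1)) * real m) ^ n"
      by (simp only: exp_add exp_of_nat_mult)
    finally have "real L ^ Suc n * real (card T) * exp (- c * (real m * r ^ n)) \<le>
        real L ^ Suc n * real (card T) * (exp (- c * real m) * exp (- (c * (r - 1)) * real m) ^ n)"
      by (intro mult_left_mono) auto
    also have "\<dots> = (real L * real (card T) * exp (- c * real m)) * (real L * exp (- (c * (r - 1)) * real m)) ^ n"
      by (simp add: power_mult_distrib)
    also have "\<dots> \<le> (1 / 4) * (1 / 2) ^ n"
      using m by (intro mult_mono power_mono) auto
    finally show "real L ^ Suc n * real (card T) * exp (- c * (real m * r ^ n)) \<le> (1/2) ^ (n + 2)"
      by (simp add: power2_eq_square)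
  qed
qed

text \<open>Step n loses at most (1/2)^(n+2) times the initial probability. The losses sum to at
  most one half of it, so at least half survives in the limit.\<close>

lemma covers_interval_pos_prob:
  "\<exists>\<Phi>. Measurable.pred (coins p) \<Phi> \<and> (\<forall>x. \<Phi> x \<longrightarrow> covers_interval L M t x) \<and>
     depends_on \<Phi> (words M) \<and> 0 < measure (coins p) {x. \<Phi> x}"
proof -
  interpret prob_space "coins p :: (nat list \<Rightarrow> bool) measure" by (rule prob_space_coins)
  obtain r \<epsilon> where r: "1 < r" and \<epsilon>: "0 < \<epsilon>"
    and r_le: "\<And>a v. a < L \<Longrightarrow> v \<in> T \<Longrightarrow> r \<le> (p - \<epsilon>) * real (card (parents a v))"
    using growth_rate by blast
  obtain m :: nat where m: "0 < m" and
    err: "\<And>n. real L ^ Suc n * real (card T) * exp (- (2 * \<epsilon>\<^sup>2) * (real m * r ^ n)) \<le> (1/2) ^ (n + 2)"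
    using error_bound[OF r, of "2 * \<epsilon>\<^sup>2"] \<epsilon> by auto
  obtain b where b: "b \<in> words L" and
    m_le: "\<And>v. v \<in> T \<Longrightarrow> m \<le> card {w \<in> words M. length w = length b \<and> track L t u0 b w = v}"
    using many_paths[of m] by blast
  let ?E = "\<lambda>n. {x. plenty_upto (real m) r b n x}"
  have pred: "Measurable.pred (coins p) (plenty_upto (real m) r b n)" for n
    by (rule pred_finite_support[OF finite_words_length_le depends_on_plenty_upto])
  then have sets: "?E n \<in> events" for n
    unfolding pred_def by simp
  \<comment> \<open>With all these coins on, the counts at level 0 are the full numbers of paths,
    which the choice of b makes at least m.\<close>
  have E0: "?E 0 = {x. \<forall>w\<in>{w \<in> words M. length w \<le> length b}. x w}"
  proof -
    have "plenty (real m) r b 0 x" if *: "\<And>w. w \<in> words M \<Longrightarrow> length w \<le> length b \<Longrightarrow> x w" for x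
    proof -
      have "alive x w" if "w \<in> words M" "length w = length b" for w
        using that * by (auto simp: alive_def take_words)
      then have "tracked b [] v x = {w \<in> words M. length w = length b \<and> track L t u0 b w = v}" for v
        by (auto simp: tracked_def)
      then show ?thesis using m_le by (auto simp: plenty_def)
    qed
    then show ?thesis by (auto simp: plenty_upto_def)
  qed
  define \<delta> where "\<delta> = prob (?E 0)"
  have \<delta>: "0 < \<delta>"
    unfolding \<delta>_def E0 using p by (subst prob_coins_all) (auto intro!: finite_words_length_le)
  \<comment> \<open>The factor is 1 minus the sum of (1/2)^(k+2) over k < n.\<close>
  have lower: "\<delta> * (1 / 2 + (1 / 2) ^ Suc n) \<le> prob (?E n)" for n
  proof (induction n)
    case 0
    then show ?case by (simp add: \<delta>_def)
  next
    case (Suc n)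
    have "?E n \<subseteq> ?E 0" by (auto simp: plenty_upto_def)
    then have le: "prob (?E n) \<le> \<delta>" unfolding \<delta>_def by (intro finite_measure_mono sets)
    let ?D = "{x. plenty_upto (real m) r b n x \<and> \<not> plenty (real m) r b (Suc n) x}"
    have "prob ?D \<le> (real L ^ Suc n * real (card T) * exp (- 2 * \<epsilon>\<^sup>2 * (real m * r ^ n))) * prob (?E n)"
      using m by (intro prob_plenty_step r \<epsilon> r_le) auto
    also have "\<dots> \<le> (1/2) ^ (n + 2) * \<delta>"
      using err[of n] le by (intro mult_mono) auto
    finally have D: "prob ?D \<le> (1/2) ^ (n + 2) * \<delta>" .
    have "?E (Suc n) \<subseteq> ?E n" by (auto simp: plenty_upto_def)
    from finite_measure_Diff[OF sets sets this]
    have "prob (?E n - ?E (Suc n)) = prob (?E n) - prob (?E (Suc n))" .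
    moreover have "?E n - ?E (Suc n) = ?D"
      by (auto simp: plenty_upto_def le_Suc_eq)
    ultimately have "prob (?E n) - prob (?E (Suc n)) \<le> (1/2) ^ (n + 2) * \<delta>"
      using D by simp
    with Suc.IH show ?case by (simp add: algebra_simps)
  qed
  define \<Phi> where "\<Phi> x \<longleftrightarrow> (\<forall>n. plenty_upto (real m) r b n x)" for x
  have "(\<lambda>n. prob (?E n)) \<longlonglongrightarrow> prob (\<Inter>n. ?E n)"
    using sets by (intro finite_Lim_measure_decseq)
      (auto simp: decseq_def plenty_upto_def)
  moreover have "(\<Inter>n. ?E n) = {x. \<Phi> x}" by (auto simp: \<Phi>_def)
  moreover have "\<delta> / 2 \<le> prob (?E n)" for n
  proof -
    have "\<delta> * (1 / 2) \<le> \<delta> * (1 / 2 + (1 / 2) ^ Suc n)" using \<delta> by (intro mult_left_mono) auto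
    then show ?thesis using lower[of n] by simp
  qed
  ultimately have "\<delta> / 2 \<le> prob {x. \<Phi> x}"
    by (intro LIMSEQ_le_const[of "\<lambda>n. prob (?E n)"]) auto
  then have "0 < prob {x. \<Phi> x}" using \<delta> by linarith
  moreover have "Measurable.pred (coins p) \<Phi>"
    unfolding \<Phi>_def[abs_def] by (intro pred_intros_countable pred)
  moreover have "depends_on \<Phi> (words M)"
  proof (rule depends_onI)
    fix x y :: "nat list \<Rightarrow> bool" assume *: "\<And>i. i \<in> words M \<Longrightarrow> x i = y i"
    have "plenty_upto (real m) r b n x = plenty_upto (real m) r b n y" for n
    proof (rule depends_onD[OF depends_on_plenty_upto])
      fix w assume "w \<in> {w \<in> words M. length w \<le> length b + n}"
      then show "x w = y w" using * by blast
    qed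
    then show "\<Phi> x = \<Phi> y" by (simp add: \<Phi>_def)
  qed
  moreover have "covers_interval L M t x" if x: "\<Phi> x" for x
  proof (rule covers_interval_if_tracked[OF b])
    fix a v assume a: "a \<in> words L" "v \<in> T"
    have "real m * r ^ length a \<le> real (card (tracked b a v x))"
      using x a unfolding \<Phi>_def plenty_upto_def plenty_def by blast
    moreover have "0 < real m * r ^ length a" using m r by simp
    ultimately have "tracked b a v x \<noteq> {}" by (auto simp: card_eq_0_iff)
    then show "\<exists>w\<in>words M. length w = length b + length a \<and> alive x w \<and> track L t u0 (b @ a) w = v"
      by (auto simp: tracked_def)
  qed
  ultimately show ?thesis by blast
qed

lemma immortal_if_covers_interval: "covers_interval L M t x \<Longrightarrow> immortal M x"
  unfolding covers_interval_def covered_def immortal_def alive_at_def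
  by (meson atLeastAtMost_iff less_imp_le order_refl)

text \<open>Covering an interval quantifies over uncountably many points and is not evidently
  measurable. \<Psi> is a measurable event, determined by the labels over [M], that implies it on
  survival; in this form the result can be transferred to another probability space.\<close>

lemma AE_covers_interval:
  "\<exists>\<Psi>. Measurable.pred (coins p) \<Psi> \<and> depends_on \<Psi> (words M) \<and> (AE x in coins p. \<Psi> x) \<and>
     (\<forall>x. \<Psi> x \<longrightarrow> immortal M x \<longrightarrow> covers_interval L M t x)"
proof -
  obtain \<Phi> where \<Phi>: "Measurable.pred (coins p) \<Phi>" "depends_on \<Phi> (words M)"
      "\<And>x. \<Phi> x \<Longrightarrow> covers_interval L M t x" "0 < measure (coins p) {x. \<Phi> x}"
    using covers_interval_pos_prob by blast
  define \<Psi> where "\<Psi> x \<longleftrightarrow> (immortal M x \<longrightarrow>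
    (\<exists>w. w \<in> words M \<and> alive x w \<and> \<Phi> (\<lambda>v. x (w @ v))))" for x
  have "Measurable.pred (coins p) \<Psi>"
    unfolding \<Psi>_def[abs_def]
    by (intro pred_intros_logic pred_intros_countable pred_immortal pred_alive
        measurable_compose[OF measurable_coins_reindex \<Phi>(1)]) simp
  moreover have "depends_on \<Psi> (words M)"
  proof (rule depends_onI)
    fix x y :: "nat list \<Rightarrow> bool" assume *: "\<And>w. w \<in> words M \<Longrightarrow> x w = y w"
    have alive: "alive x w = alive y w" if "w \<in> words M" for w
      using that by (intro alive_cong *) (auto simp: take_words)
    then have "immortal M x = immortal M y" by (auto simp: immortal_def alive_at_def)
    moreover have "\<Phi> (\<lambda>v. x (w @ v)) = \<Phi> (\<lambda>v. y (w @ v))" if "w \<in> words M" for w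
      using that by (intro depends_onD[OF \<Phi>(2)] *) auto
    ultimately show "\<Psi> x = \<Psi> y" using alive by (auto simp: \<Psi>_def)
  qed
  moreover have "AE x in coins p. \<Psi> x"
  proof -
    have "AE x in coins p. immortal M x \<longrightarrow> (\<exists>w\<in>words M. alive x w \<and> \<Phi> (\<lambda>v. x (w @ v)))"
      by (rule AE_immortal_imp_descendant[OF p M_ge_2 \<Phi>(1) immortal_if_covers_interval[OF \<Phi>(3)] \<Phi>(4)])
    then show ?thesis
      by eventually_elim (auto simp: \<Psi>_def)
  qed
  moreover have "covers_interval L M t x" if "\<Psi> x" "immortal M x" for x
    using that \<Phi>(3) covers_interval_append unfolding \<Psi>_def by blast
  ultimately show ?thesis by blast
qed

end

section \<open>Basic types\<close>

text \<open>Both intervals have length 1, so comparing left ends is enough.\<close>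

lemma affine_image_eq_iff:
  assumes "L > 0"
  shows "(\<lambda>x. x / real L + real c) ` {of_int u * real L..(of_int u + 1) * real L} =
      {of_int v * real L + real a..of_int v * real L + real a + 1} \<longleftrightarrow>
    u + int c = v * int L + int a"
proof -
  have "(\<lambda>x. x / real L + real c) ` {of_int u * real L..(of_int u + 1) * real L} =
      {of_int u + real c..of_int u + 1 + real c}"
    using assms by (subst image_affinity_atLeastAtMost_div) auto
  also have "\<dots> = {of_int v * real L + real a..of_int v * real L + real a + 1} \<longleftrightarrow>
      of_int u + real c = of_int v * real L + real a"
    by (auto simp: Icc_eq_Icc)
  also have "\<dots> \<longleftrightarrow> real_of_int (u + int c) = real_of_int (v * int L + int a)" by simp
  also have "\<dots> \<longleftrightarrow> u + int c = v * int L + int a" by (rule of_int_eq_iff)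
  finally show ?thesis .
qed

lemma distinct_trans_bij: "bij_betw (distinct_trans M t) {..<num_distinct M t} (t ` {..<M})"
  unfolding distinct_trans_def[abs_def] num_distinct_def
  by (rule bij_betw_nth) auto

lemma type_index_bij:
  "finite (type_indices L M t) \<Longrightarrow>
    bij_betw (type_index L M t) {..<num_types L M t} (type_indices L M t)"
  unfolding type_index_def[abs_def] num_types_def
  by (rule bij_betw_nth) auto

lemma multiplicity_of_eq: "multiplicity_of L M t j = card {i. i < M \<and> t i = distinct_trans M t j}"
proof -
  have "ifs_map L t i = distinct_map L M t j \<longleftrightarrow> t i = distinct_trans M t j" for i
    by (auto simp: distinct_map_def ifs_map_def fun_eq_iff)
  then show ?thesis by (simp add: multiplicity_of_def)
qed

text \<open>The position of the cylinder fixes the translation, so at most one distinct map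
  qualifies, and its multiplicity counts the original maps with that translation.\<close>

lemma type_matrix_entry:
  assumes "L > 0" "l < num_types L M t" "k < num_types L M t"
  shows "type_matrix L M t a $$ (l, k) =
    card {i. i < M \<and> type_index L M t k + int (t i) = type_index L M t l * int L + int a}"
proof -
  let ?C = "\<lambda>c. type_index L M t k + int c = type_index L M t l * int L + int a"
  have cond: "distinct_map L M t i ` basic_type L M t k = type_cylinder L M t l [a] \<longleftrightarrow>
      ?C (distinct_trans M t i)" for i
    using affine_image_eq_iff[OF assms(1)] assms(1)
    by (simp add: distinct_map_def ifs_map_def basic_type_def type_cylinder_def Let_def)
  have entry: "type_matrix L M t a $$ (l, k) =
      (if \<exists>i<num_distinct M t. ?C (distinct_trans M t i)
       then multiplicity_of L M t (THE i. i < num_distinct M t \<and> ?C (distinct_trans M t i)) else 0)"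
    using assms by (simp add: type_matrix_def cond) blast
  show ?thesis
  proof (cases "\<exists>i<num_distinct M t. ?C (distinct_trans M t i)")
    case True
    then obtain j where j: "j < num_distinct M t" "?C (distinct_trans M t j)" by blast
    have uniq: "i = j" if "i < num_distinct M t" "?C (distinct_trans M t i)" for i
    proof -
      have "distinct_trans M t i = distinct_trans M t j" using that j by linarith
      then show ?thesis
        using distinct_trans_bij[of M t] that j by (auto simp: bij_betw_def inj_on_def)
    qed
    have "(THE i. i < num_distinct M t \<and> ?C (distinct_trans M t i)) = j"
      by (rule the_equality) (use j uniq in blast)+
    then have "type_matrix L M t a $$ (l, k) = card {i. i < M \<and> t i = distinct_trans M t j}"
      using True by (simp only: entry if_True multiplicity_of_eq)
    also have "{i. i < M \<and> t i = distinct_trans M t j} = {i. i < M \<and> ?C (t i)}"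
      using j by auto
    finally show ?thesis .
  next
    case False
    have "{i. i < M \<and> ?C (t i)} = {}"
    proof (rule ccontr)
      assume "{i. i < M \<and> ?C (t i)} \<noteq> {}"
      then obtain i where i: "i < M" "?C (t i)" by blast
      then have "t i \<in> distinct_trans M t ` {..<num_distinct M t}"
        using distinct_trans_bij[of M t] by (simp add: bij_betw_def)
      with i False show False by auto
    qed
    with False show ?thesis by (simp only: entry if_False card.empty)
  qed
qed

text \<open>Identifies the column sum with the cardinality in \<open>growth\<close>: rows correspond
  to parent types, entries count parent letters.\<close>

lemma column_sum_eq:
  assumes "L > 0" and fin: "finite (type_indices L M t)" and "k < num_types L M t"
  shows "column_sum L M t a k = card {(u, i). u \<in> type_indices L M t \<and> i < M \<and>
    type_index L M t k + int (t i) = u * int L + int a}"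
proof -
  let ?S = "\<lambda>u. {i. i < M \<and> type_index L M t k + int (t i) = u * int L + int a}"
  have "column_sum L M t a k = (\<Sum>l<num_types L M t. card (?S (type_index L M t l)))"
    unfolding column_sum_def using assms by (intro sum.cong) (simp_all add: type_matrix_entry)
  also have "\<dots> = (\<Sum>u\<in>type_indices L M t. card (?S u))"
    by (rule sum.reindex_bij_betw[OF type_index_bij[OF fin]])
  also have "\<dots> = card (SIGMA u:type_indices L M t. ?S u)"
    using fin by (subst card_SigmaI) auto
  also have "(SIGMA u:type_indices L M t. ?S u) = {(u, i). u \<in> type_indices L M t \<and> i < M \<and>
      type_index L M t k + int (t i) = u * int L + int a}"
    by auto
  finally show ?thesis .
qed

lemma type_matrix_word_carrier:
  "type_matrix_word L M t w \<in> carrier_mat (num_types L M t) (num_types L M t)"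
proof (induction w)
  case (Cons a w)
  have "type_matrix L M t a \<in> carrier_mat (num_types L M t) (num_types L M t)"
    by (simp add: type_matrix_def)
  with Cons show ?case by (simp add: type_matrix_word_def)
qed (simp add: type_matrix_word_def)

text \<open>A positive entry of a product of matrices over the naturals has a positive summand,
  which provides an intermediate type; these types are followed letter by letter.\<close>

lemma type_matrix_word_pos_imp_track:
  assumes "L > 0" "l < num_types L M t" "k < num_types L M t" "0 < type_matrix_word L M t w $$ (l, k)"
  shows "\<exists>v\<in>words M. length v = length w \<and>
    track L t (type_index L M t l) w v = type_index L M t k"
  using assms(2-)
proof (induction w arbitrary: l)
  case Nil
  then have "l = k" by (auto simp: type_matrix_word_def split: if_splits)
  then show ?case by (intro bexI[of _ "[]"]) auto
next
  case (Cons a w)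
  let ?N = "num_types L M t"
  have "type_matrix_word L M t (a # w) = type_matrix L M t a * type_matrix_word L M t w"
    by (simp add: type_matrix_word_def)
  moreover have "type_matrix L M t a \<in> carrier_mat ?N ?N"
    by (simp add: type_matrix_def)
  ultimately have "type_matrix_word L M t (a # w) $$ (l, k) =
      (\<Sum>j<?N. type_matrix L M t a $$ (l, j) * type_matrix_word L M t w $$ (j, k))"
    using Cons.prems type_matrix_word_carrier[of L M t w]
    by (simp add: scalar_prod_def atLeast0LessThan)
  then have "(\<Sum>j<?N. type_matrix L M t a $$ (l, j) * type_matrix_word L M t w $$ (j, k)) \<noteq> 0"
    using Cons.prems by linarith
  from sum.not_neutral_contains_not_neutral[OF this]
  obtain j where j: "j < ?N" "0 < type_matrix L M t a $$ (l, j)"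
      "0 < type_matrix_word L M t w $$ (j, k)"
    by auto
  then have "{i. i < M \<and> type_index L M t j + int (t i) = type_index L M t l * int L + int a} \<noteq> {}"
    using type_matrix_entry[OF assms(1) Cons.prems(1) j(1), of a] by (metis card.empty less_numeral_extra(3))
  then obtain i where i: "i < M" "type_index L M t l * int L + int a - int (t i) = type_index L M t j"
    by (auto simp: algebra_simps)
  obtain v where v: "v \<in> words M" "length v = length w"
      "track L t (type_index L M t j) w v = type_index L M t k"
    using Cons.IH[OF j(1) Cons.prems(2) j(3)] by blast
  then show ?case using i by (intro bexI[of _ "i # v"]) auto
qed

section \<open>From labelled trees to the coin set\<close>

lemma contains_interval_if_covers_interval:
  assumes "covers_interval L M t (\<lambda>w. w = [] \<or> X w \<omega>)"
  shows "contains_interval (coin_set L M t X \<omega>)"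
proof -
  obtain c d where "c < d" and cov: "\<And>z. z \<in> {c..d} \<Longrightarrow> covered L M t (\<lambda>w. w = [] \<or> X w \<omega>) z"
    using assms unfolding covers_interval_def by blast
  moreover have "z \<in> coin_set L M t X \<omega>" if z: "z \<in> {c..d}" for z
    unfolding coin_set_def
  proof
    fix n :: nat
    obtain w where w: "w \<in> words M" "length w = n" "alive (\<lambda>w. w = [] \<or> X w \<omega>) w"
        "z \<in> ifs_word L t w ` base_interval L M t"
      using cov[OF z] unfolding covered_def by blast
    then have "w \<in> surviving X M \<omega> n"
      by (fastforce simp: surviving_def alive_def)
    with w show "z \<in> (\<Union>w\<in>surviving X M \<omega> n. ifs_word L t w ` base_interval L M t)" by blast
  qed
  ultimately show ?thesis unfolding contains_interval_def by blast
qed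

lemma non_extinct_imp_immortal:
  assumes "non_extinct X M \<omega>"
  shows "immortal M (\<lambda>w. w = [] \<or> X w \<omega>)"
  unfolding immortal_def alive_at_def
proof
  fix n
  obtain w where "w \<in> surviving X M \<omega> n" using assms unfolding non_extinct_def by blast
  then have "w \<in> words M" "length w = n" "\<And>k. k \<in> {1..n} \<Longrightarrow> X (take k w) \<omega>"
    by (auto simp: surviving_def)
  then show "\<exists>w\<in>words M. length w = n \<and> alive (\<lambda>w. w = [] \<or> X w \<omega>) w"
    by (intro bexI[of _ w]) (auto simp: alive_def Suc_le_eq)
qed

text \<open>The empty word has no label in \<open>X\<close>, so the result is applied to the M
  subtrees at depth one. Their words are nonempty in the original tree, and each subtree has the law
  of the canonical one.\<close>

lemma (in typed_ifs) AE_contains_interval: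
  assumes P: "prob_space P" and X: "bernoulli_labels P X M p"
  shows "AE \<omega> in P. non_extinct X M \<omega> \<longrightarrow> contains_interval (coin_set L M t X \<omega>)"
proof -
  obtain \<Psi> where pred: "Measurable.pred (coins p) \<Psi>" and dep: "depends_on \<Psi> (words M)"
    and AE: "AE x in coins p. \<Psi> x"
    and cov: "\<And>x. \<Psi> x \<Longrightarrow> immortal M x \<Longrightarrow> covers_interval L M t x"
    using AE_covers_interval by blast
  have "AE \<omega> in P. \<Psi> (\<lambda>v. X (i # v) \<omega>)" if i: "i < M" for i
  proof (rule AE_coins_transfer[where I = "words M - {[]}" and \<Phi> = "\<lambda>x. \<Psi> (\<lambda>v. x (i # v))"])
    show "words M - {[]} \<noteq> {}" using i by (metis Diff_eq_empty_iff list.distinct(1) singletonD subsetD words_simps(1,2))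
    show "prob_space.indep_vars P (\<lambda>_. count_space UNIV) X (words M - {[]})"
      using X by (simp add: bernoulli_labels_def)
    show "distr P (count_space UNIV) (X w) = measure_pmf (bernoulli_pmf p)" if "w \<in> words M - {[]}" for w
      using X that by (auto simp: bernoulli_labels_def)
    show "Measurable.pred (coins p) (\<lambda>x. \<Psi> (\<lambda>v. x (i # v)))"
      by (rule measurable_compose[OF measurable_coins_reindex pred])
    show "depends_on (\<lambda>x. \<Psi> (\<lambda>v. x (i # v))) (words M - {[]})"
      using i by (intro depends_onI depends_onD[OF dep]) auto
    show "AE x in coins p. \<Psi> (\<lambda>v. x (i # v))"
    proof -
      have "AE x in distr (coins p) (coins p) (\<lambda>x v. x (i # v)). \<Psi> x"
        by (subst distr_coins_reindex) (simp_all add: AE)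
      from AE_distrD[OF measurable_coins_reindex this] show ?thesis .
    qed
  qed (fact P)
  then have "AE \<omega> in P. \<forall>i\<in>{..<M}. \<Psi> (\<lambda>v. X (i # v) \<omega>)"
    by (intro AE_finite_allI) auto
  then show ?thesis
  proof eventually_elim
    case (elim \<omega>)
    show ?case
    proof
      assume "non_extinct X M \<omega>"
      then have "immortal M (\<lambda>w. w = [] \<or> X w \<omega>)" by (rule non_extinct_imp_immortal)
      \<comment> \<open>With the empty word declared on, survival passes to one of the depth-one
        subtrees, where the almost sure event applies.\<close>
      then obtain i where i: "i < M" "immortal M (\<lambda>v. X (i # v) \<omega>)"
        by (subst (asm) immortal_iff) auto
      then have "covers_interval L M t (\<lambda>v. X (i # v) \<omega>)" using elim cov by auto
      then have "covers_interval L M t (\<lambda>w. w = [] \<or> X w \<omega>)"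
        by (intro covers_interval_Cons[where x = "\<lambda>w. w = [] \<or> X w \<omega>", OF _ i(1)]) simp_all
      then show "contains_interval (coin_set L M t X \<omega>)"
        by (rule contains_interval_if_covers_interval)
    qed
  qed
qed

theorem theorem1p9:
  fixes L M :: nat
    and t :: "nat \<Rightarrow> nat"
    and p :: real
    and P :: "'w measure"
    and X :: "nat list \<Rightarrow> 'w \<Rightarrow> bool"
  assumes "L \<ge> 2" and "M \<ge> 1"
    and "t 0 = 0" and "mono_on {..<M} t" and "(L - 1) dvd t (M - 1)"
    and "0 < p" and "p < 1"
    and "prob_space P" and "bernoulli_labels P X M p"
    and "\<And>a U. a < L \<Longrightarrow> U < num_types L M t \<Longrightarrow> p * real (column_sum L M t a U) > 1"
    and "\<exists>b \<in> words L. \<exists>U < num_types L M t. \<forall>V < num_types L M t.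
           type_matrix_word L M t b $$ (U, V) > 0"
  shows "AE \<omega> in P. non_extinct X M \<omega> \<longrightarrow> contains_interval (coin_set L M t X \<omega>)"
proof -
  obtain b U where b: "b \<in> words L" "U < num_types L M t"
      "\<And>V. V < num_types L M t \<Longrightarrow> 0 < type_matrix_word L M t b $$ (U, V)"
    using assms(11) by blast
  have L: "L > 0" using assms(1) by simp
  \<comment> \<open>Infinite sets have \<open>card\<close> equal to 0, so the existence of the index
    U below \<open>num_types\<close> already gives finiteness.\<close>
  have fin: "finite (type_indices L M t)"
    using b(2) by (intro card_ge_0_finite) (simp add: num_types_def)
  note bij = type_index_bij[OF fin]
  obtain K where K: "t (M - 1) = (L - 1) * K" using assms(5) by blast
  have index: "\<exists>k<num_types L M t. v = type_index L M t k" if "v \<in> type_indices L M t" for v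
    using bij that by (auto simp: bij_betw_def)
  interpret typed_ifs L M K t "type_indices L M t" "type_index L M t U" p
  proof
    show "t i \<le> t (M - 1)" if "i < M" for i
      using assms(4) that by (auto intro: mono_onD)
    show "t (M - 1) = K * (L - 1)" using K by simp
    show "type_index L M t U \<in> type_indices L M t"
      using bij b(2) by (auto simp: bij_betw_def)
    show "1 < p * real (card {(u, i). u \<in> type_indices L M t \<and> i < M \<and> v + int (t i) = u * int L + int a})"
      if "v \<in> type_indices L M t" "a < L" for a v
      using index[OF that(1)] assms(10)[OF that(2)] by (auto simp: column_sum_eq[OF L fin])
    show "\<exists>b\<in>words L. \<forall>v\<in>type_indices L M t. \<exists>w\<in>words M. length w = length b \<and>
        track L t (type_index L M t U) b w = v"
    proof (intro bexI[OF _ b(1)] ballI)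
      fix v assume "v \<in> type_indices L M t"
      then obtain k where "k < num_types L M t" "v = type_index L M t k" using index by blast
      then show "\<exists>w\<in>words M. length w = length b \<and> track L t (type_index L M t U) b w = v"
        using type_matrix_word_pos_imp_track[OF L b(2) _ b(3)] by blast
    qed
  qed (use assms fin in auto)
  show ?thesis by (rule AE_contains_interval[OF assms(8,9)])
qed

end
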